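(* There exists a constant $C_b$, independent of the parameters $\lambda, R_i^{-1}, \alpha_{p_i}, \alpha_{ij}$ ($i,j=1,\dots,n$) and of the network scale $n$, such that for all $(\boldsymbol u;\boldsymbol v;\boldsymbol p)\in \boldsymbol U\times\boldsymbol V\times\boldsymbol P$ and all $(\boldsymbol w;\boldsymbol z;\boldsymbol q)\in \boldsymbol U\times\boldsymbol V\times\boldsymbol P$ $$|\mathcal A((\boldsymbol u;\boldsymbol v;\boldsymbol p),(\boldsymbol w;\boldsymbol z;\boldsymbol q))|\le C_b\,(\|\boldsymbol u\|_{\boldsymbol U}+\|\boldsymbol v\|_{\boldsymbol V}+\|\boldsymbol p\|_{\boldsymbol P})\,(\|\boldsymbol w\|_{\boldsymbol U}+\|\boldsymbol z\|_{\boldsymbol V}+\|\boldsymbol q\|_{\boldsymbol P}).$$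
   Context: Domain and spaces: $\Omega\subset\mathbb R^d$, $d\in\{2,3\}$, is a bounded connected Lipschitz domain; $(\cdot,\cdot)$ and $\|\cdot\|$ are the $L^2(\Omega)$ inner product and norm (for scalar, vector or tensor functions). $\boldsymbol\epsilon(\boldsymbol u)=\frac12(\nabla\boldsymbol u+(\nabla\boldsymbol u)^T)$. $n\ge1$ is an integer (network scale). $\boldsymbol U=H^1_0(\Omega)^d$; $\boldsymbol V_i=H_0(\operatorname{div},\Omega)$ (fields in $L^2(\Omega)^d$ with divergence in $L^2(\Omega)$ and zero normal trace on $\partial\Omega$); $P_i=L^2_0(\Omega)=\{p\in L^2(\Omega):\int_\Omega p\,dx=0\}$, $i=1,\dots,n$; $\boldsymbol V=\boldsymbol V_1\times\dots\times\boldsymbol V_n$, $\boldsymbol P=P_1\times\dots\times P_n$. For $\boldsymbol v=(\boldsymbol v_1,\dots,\boldsymbol v_n)\in\boldsymbol V$, $\operatorname{Div}\boldsymbol v=(\operatorname{div}\boldsymbol v_1,\dots,\operatorname{div}\boldsymbol v_n)^T$; $\boldsymbol p=(p_1,\dots,p_n)^T$. Parameters: constants $\lambda>0$; $R_i^{-1}>0$ and $\alpha_{p_i}\ge0$ for $i=1,\dots,n$; $\alpha_{ij}=\frac{\tau\beta_{ij}}{\alpha_i\alpha_j}\ge0$ for $i,j=1,\dots,n$, where $\tau>0$, $\alpha_i>0$, $\beta_{ij}=\beta_{ji}\ge 0$ for $i\ne j$, and $\beta_{ii}=\sum_{j\neq i}\beta_{ij}$. Set $R^{-1}=\max\{R_1^{-1},\dots,R_n^{-1}\}$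 and $\lambda_0=\max\{1,\lambda\}$. Matrices ($n\times n$): $\Lambda_1$ has diagonal entries $\alpha_{ii}$ and off-diagonal entries $-\alpha_{ij}$; $\Lambda_2=\operatorname{diag}(\alpha_{p_1},\dots,\alpha_{p_n})$; $\Lambda_3=R\,I$; $\Lambda_4$ has all entries equal to $1/\lambda_0$; $\Lambda=\Lambda_1+\Lambda_2+\Lambda_3+\Lambda_4$ (symmetric positive definite). Norms: induced by the inner products $(\boldsymbol u,\boldsymbol w)_{\boldsymbol U}=(\boldsymbol\epsilon(\boldsymbol u),\boldsymbol\epsilon(\boldsymbol w))+\lambda(\operatorname{div}\boldsymbol u,\operatorname{div}\boldsymbol w)$, $(\boldsymbol v,\boldsymbol z)_{\boldsymbol V}=\sum_{i=1}^n(R_i^{-1}\boldsymbol v_i,\boldsymbol z_i)+(\Lambda^{-1}\operatorname{Div}\boldsymbol v,\operatorname{Div}\boldsymbol z)$, $(\boldsymbol p,\boldsymbol q)_{\boldsymbol P}=(\Lambda\boldsymbol p,\boldsymbol q)$. Bilinear form: $$\begin{aligned}\mathcal A((\boldsymbol u;\boldsymbol v;\boldsymbol p),(\boldsymbol w;\boldsymbol z;\boldsymbol q))=&(\boldsymbol\epsilon(\boldsymbol u),\boldsymbol\epsilon(\boldsymbol w))+\lambda(\operatorname{div}\boldsymbol u,\operatorname{div}\boldsymbol w)-\Big(\sum_{i=1}^np_i,\operatorname{div}\boldsymbol w\Big)+\sum_{i=1}^n(R_i^{-1}\boldsymbol v_i,\boldsymbol z_i)-(\boldsymbol p,\operatorname{Div}\boldsymbol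 z)\\&-\Big(\operatorname{div}\boldsymbol u,\sum_{i=1}^nq_i\Big)-(\operatorname{Div}\boldsymbol v,\boldsymbol q)-((\Lambda_1+\Lambda_2)\boldsymbol p,\boldsymbol q).\end{aligned}$$ "Independent of the parameters" means that one constant works for all admissible parameter values and all $n\ge 1$. *)

theory Defs
  imports
    "HOL-Analysis.Analysis"
    "Jordan_Normal_Form.Gauss_Jordan_Elimination"
begin

no_notation Matrix.vec_index (infixl "$" 100)
no_notation Matrix.scalar_prod (infix "\<bullet>" 70)

section \<open>Bounded Lipschitz domains\<close>

text \<open>
  Near every boundary point, \<open>\<Omega>\<close> is the region strictly above the graph of a Lipschitz
  function \<open>\<gamma>\<close> over the hyperplane orthogonal to some unit vector \<open>e\<close> (the vertical direction of
  the rotated coordinate system).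
\<close>

definition lipschitz_boundary :: "(real^'d) set \<Rightarrow> bool" where
  "lipschitz_boundary \<Omega> \<longleftrightarrow>
     (\<forall>x0\<in>frontier \<Omega>. \<exists>r>0. \<exists>e. \<exists>\<gamma>::real^'d \<Rightarrow> real. \<exists>L.
        norm e = 1 \<and> L-lipschitz_on {y. inner e y = 0} \<gamma> \<and>
        (\<forall>y\<in>ball x0 r. y \<in> \<Omega> \<longleftrightarrow> inner e y > \<gamma> (y - inner e y *\<^sub>R e)))"

definition bounded_lipschitz_domain :: "(real^'d) set \<Rightarrow> bool" where
  "bounded_lipschitz_domain \<Omega> \<longleftrightarrow>
     open \<Omega> \<and> \<Omega> \<noteq> {} \<and> connected \<Omega> \<and> bounded \<Omega> \<and> lipschitz_boundary \<Omega>"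

section \<open>Square-integrable functions and test functions\<close>

text \<open>
  Elements of \<open>L\<^sup>2\<close> are represented by functions rather than by classes modulo null sets.
  The value type covers scalars, vectors, and matrices; for the latter \<open>inner\<close> is the
  Frobenius product.
\<close>

definition L2 :: "(real^'d) set \<Rightarrow> (real^'d \<Rightarrow> 'b::euclidean_space) set" where
  "L2 \<Omega> = {f. f \<in> borel_measurable (lebesgue_on \<Omega>) \<and>
               integrable (lebesgue_on \<Omega>) (\<lambda>x. (norm (f x))\<^sup>2)}"

definition l2_inner ::
  "(real^'d) set \<Rightarrow> (real^'d \<Rightarrow> 'b::euclidean_space) \<Rightarrow> (real^'d \<Rightarrow> 'b) \<Rightarrow> real" where
  "l2_inner \<Omega> f g = (LINT x|lebesgue_on \<Omega>. inner (f x) (g x))"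

definition partial_deriv :: "'d \<Rightarrow> (real^'d \<Rightarrow> real) \<Rightarrow> real^'d \<Rightarrow> real" where
  "partial_deriv i f x = frechet_derivative f (at x) (axis i 1)"

text \<open>All iterated partial derivatives exist and are differentiable, i.e. \<open>C\<^sup>\<infinity>\<close>.\<close>

definition smooth :: "(real^'d \<Rightarrow> real) \<Rightarrow> bool" where
  "smooth f \<longleftrightarrow> (\<forall>is x. fold partial_deriv is f differentiable (at x))"

definition test_functions :: "(real^'d) set \<Rightarrow> (real^'d \<Rightarrow> real) set" where
  "test_functions \<Omega> =
     {\<phi>. smooth \<phi> \<and> compact (closure {x. \<phi> x \<noteq> 0}) \<and> closure {x. \<phi> x \<noteq> 0} \<subseteq> \<Omega>}"

section \<open>Weak derivatives\<close>

text \<open>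
  Weak derivatives are unique up to null sets; \<open>SOME\<close> picks a representative.
\<close>

definition has_weak_partial ::
  "(real^'d) set \<Rightarrow> 'd \<Rightarrow> (real^'d \<Rightarrow> real) \<Rightarrow> (real^'d \<Rightarrow> real) \<Rightarrow> bool" where
  "has_weak_partial \<Omega> i f g \<longleftrightarrow>
     (\<forall>\<phi>\<in>test_functions \<Omega>. l2_inner \<Omega> f (partial_deriv i \<phi>) = - l2_inner \<Omega> g \<phi>)"

definition weak_partial ::
  "(real^'d) set \<Rightarrow> 'd \<Rightarrow> (real^'d \<Rightarrow> real) \<Rightarrow> real^'d \<Rightarrow> real" where
  "weak_partial \<Omega> i f = (SOME g. g \<in> L2 \<Omega> \<and> has_weak_partial \<Omega> i f g)"

definition weak_grad :: "(real^'d) set \<Rightarrow> (real^'d \<Rightarrow> real) \<Rightarrow> real^'d \<Rightarrow> real^'d" where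
  "weak_grad \<Omega> f x = (\<chi> i. weak_partial \<Omega> i f x)"

definition weak_jacobian ::
  "(real^'d) set \<Rightarrow> (real^'d \<Rightarrow> real^'d) \<Rightarrow> real^'d \<Rightarrow> real^'d^'d" where
  "weak_jacobian \<Omega> u x = (\<chi> i. weak_grad \<Omega> (\<lambda>y. u y $ i) x)"

definition sym_grad ::
  "(real^'d) set \<Rightarrow> (real^'d \<Rightarrow> real^'d) \<Rightarrow> real^'d \<Rightarrow> real^'d^'d" where
  "sym_grad \<Omega> u x = (1/2) *\<^sub>R (weak_jacobian \<Omega> u x + transpose (weak_jacobian \<Omega> u x))"

text \<open>
  For a field with \<open>H\<^sup>1\<close> components the divergence is the sum of the partial derivatives; for a
  field in \<open>H(div)\<close>, whose individual partial derivatives need not exist, it is the distributional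
  divergence. Lemma \<open>has_weak_div_div_H1\<close> below shows that the former is an instance of the latter.
\<close>

definition div_H1 :: "(real^'d) set \<Rightarrow> (real^'d \<Rightarrow> real^'d) \<Rightarrow> real^'d \<Rightarrow> real" where
  "div_H1 \<Omega> u x = (\<Sum>i\<in>UNIV. weak_partial \<Omega> i (\<lambda>y. u y $ i) x)"

definition has_weak_div ::
  "(real^'d) set \<Rightarrow> (real^'d \<Rightarrow> real^'d) \<Rightarrow> (real^'d \<Rightarrow> real) \<Rightarrow> bool" where
  "has_weak_div \<Omega> v g \<longleftrightarrow>
     (\<forall>\<phi>\<in>test_functions \<Omega>.
        l2_inner \<Omega> v (\<lambda>x. \<chi> i. partial_deriv i \<phi> x) = - l2_inner \<Omega> g \<phi>)"

definition weak_div :: "(real^'d) set \<Rightarrow> (real^'d \<Rightarrow> real^'d) \<Rightarrow> real^'d \<Rightarrow> real" where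
  "weak_div \<Omega> v = (SOME g. g \<in> L2 \<Omega> \<and> has_weak_div \<Omega> v g)"

section \<open>Function spaces\<close>

definition H1 :: "(real^'d) set \<Rightarrow> (real^'d \<Rightarrow> real) set" where
  "H1 \<Omega> = {f \<in> L2 \<Omega>. \<forall>i. \<exists>g\<in>L2 \<Omega>. has_weak_partial \<Omega> i f g}"

definition H1_norm :: "(real^'d) set \<Rightarrow> (real^'d \<Rightarrow> real) \<Rightarrow> real" where
  "H1_norm \<Omega> f = sqrt (l2_inner \<Omega> f f + l2_inner \<Omega> (weak_grad \<Omega> f) (weak_grad \<Omega> f))"

text \<open>The closure of the test functions in \<open>H\<^sup>1\<close>.\<close>

definition H10 :: "(real^'d) set \<Rightarrow> (real^'d \<Rightarrow> real) set" where
  "H10 \<Omega> = {f \<in> H1 \<Omega>. \<exists>\<phi>. (\<forall>k::nat. \<phi> k \<in> test_functions \<Omega>) \<and>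
                 (\<lambda>k. H1_norm \<Omega> (\<lambda>x. f x - \<phi> k x)) \<longlonglongrightarrow> 0}"

definition H10_vec :: "(real^'d) set \<Rightarrow> (real^'d \<Rightarrow> real^'d) set" where
  "H10_vec \<Omega> = {u. \<forall>i. (\<lambda>x. u x $ i) \<in> H10 \<Omega>}"

definition Hdiv :: "(real^'d) set \<Rightarrow> (real^'d \<Rightarrow> real^'d) set" where
  "Hdiv \<Omega> = {v \<in> L2 \<Omega>. \<exists>g\<in>L2 \<Omega>. has_weak_div \<Omega> v g}"

text \<open>
  The normal trace of an \<open>H(div)\<close> field is the functional on (traces of) \<open>H\<^sup>1\<close> functions given by
  Green's formula: \<open>\<langle>v \<cdot> n, \<psi>\<rangle> = (v, \<nabla>\<psi>) + (div v, \<psi>)\<close>.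
\<close>

definition normal_trace ::
  "(real^'d) set \<Rightarrow> (real^'d \<Rightarrow> real^'d) \<Rightarrow> (real^'d \<Rightarrow> real) \<Rightarrow> real" where
  "normal_trace \<Omega> v \<psi> = l2_inner \<Omega> v (weak_grad \<Omega> \<psi>) + l2_inner \<Omega> (weak_div \<Omega> v) \<psi>"

definition H0div :: "(real^'d) set \<Rightarrow> (real^'d \<Rightarrow> real^'d) set" where
  "H0div \<Omega> = {v \<in> Hdiv \<Omega>. \<forall>\<psi>\<in>H1 \<Omega>. normal_trace \<Omega> v \<psi> = 0}"

definition L20 :: "(real^'d) set \<Rightarrow> (real^'d \<Rightarrow> real) set" where
  "L20 \<Omega> = {p \<in> L2 \<Omega>. (LINT x|lebesgue_on \<Omega>. p x) = 0}"

section \<open>Network-valued functions\<close>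

text \<open>
  Network indices \<open>1, \<dots>, n\<close> are rendered as \<open>0, \<dots>, n - 1\<close>, so that matrices of varying size can be
  used. An \<open>n\<close>-tuple of functions is an extensional function on \<open>{..<n}\<close>.
\<close>

definition V_space :: "nat \<Rightarrow> (real^'d) set \<Rightarrow> (nat \<Rightarrow> real^'d \<Rightarrow> real^'d) set" where
  "V_space n \<Omega> = ({..<n} \<rightarrow>\<^sub>E H0div \<Omega>)"

definition P_space :: "nat \<Rightarrow> (real^'d) set \<Rightarrow> (nat \<Rightarrow> real^'d \<Rightarrow> real) set" where
  "P_space n \<Omega> = ({..<n} \<rightarrow>\<^sub>E L20 \<Omega>)"

definition Div :: "(real^'d) set \<Rightarrow> (nat \<Rightarrow> real^'d \<Rightarrow> real^'d) \<Rightarrow> nat \<Rightarrow> real^'d \<Rightarrow> real" where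
  "Div \<Omega> v i = weak_div \<Omega> (v i)"

definition l2_inner_tuple ::
  "nat \<Rightarrow> (real^'d) set \<Rightarrow> (nat \<Rightarrow> real^'d \<Rightarrow> real) \<Rightarrow> (nat \<Rightarrow> real^'d \<Rightarrow> real) \<Rightarrow> real" where
  "l2_inner_tuple n \<Omega> p q = (\<Sum>i<n. l2_inner \<Omega> (p i) (q i))"

definition mat_apply ::
  "real mat \<Rightarrow> (nat \<Rightarrow> real^'d \<Rightarrow> real) \<Rightarrow> nat \<Rightarrow> real^'d \<Rightarrow> real" where
  "mat_apply M p i x = (\<Sum>j<dim_col M. M $$ (i, j) * p j x)"

section \<open>Parameters and parameter matrices\<close>

text \<open>
  \<open>Rinv i\<close> stands for \<open>R\<^sub>i\<^sup>-\<^sup>1\<close>, \<open>ap i\<close> for \<open>\<alpha>\<close> with index \<open>p\<^sub>i\<close>, and \<open>a i j\<close> for \<open>\<alpha>\<close> with index \<open>ij\<close>.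
\<close>

definition admissible ::
  "nat \<Rightarrow> real \<Rightarrow> (nat \<Rightarrow> real) \<Rightarrow> (nat \<Rightarrow> real) \<Rightarrow> (nat \<Rightarrow> nat \<Rightarrow> real) \<Rightarrow> bool" where
  "admissible n lam Rinv ap a \<longleftrightarrow>
     lam > 0 \<and> (\<forall>i<n. Rinv i > 0) \<and> (\<forall>i<n. ap i \<ge> 0) \<and>
     (\<exists>(\<tau>::real) (\<alpha>::nat \<Rightarrow> real) (\<beta>::nat \<Rightarrow> nat \<Rightarrow> real).
        \<tau> > 0 \<and> (\<forall>i<n. \<alpha> i > 0) \<and>
        (\<forall>i<n. \<forall>j<n. i \<noteq> j \<longrightarrow> \<beta> i j = \<beta> j i \<and> \<beta> i j \<ge> 0) \<and>
        (\<forall>i<n. \<beta> i i = (\<Sum>j\<in>{..<n} - {i}. \<beta> i j)) \<and>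
        (\<forall>i<n. \<forall>j<n. a i j = \<tau> * \<beta> i j / (\<alpha> i * \<alpha> j)))"

definition R_const :: "nat \<Rightarrow> (nat \<Rightarrow> real) \<Rightarrow> real" where
  "R_const n Rinv = inverse (Max (Rinv ` {..<n}))"

definition lam0 :: "real \<Rightarrow> real" where
  "lam0 lam = max 1 lam"

definition Lam1 :: "nat \<Rightarrow> (nat \<Rightarrow> nat \<Rightarrow> real) \<Rightarrow> real mat" where
  "Lam1 n a = Matrix.mat n n (\<lambda>(i, j). if i = j then a i i else - a i j)"

definition Lam2 :: "nat \<Rightarrow> (nat \<Rightarrow> real) \<Rightarrow> real mat" where
  "Lam2 n ap = Matrix.mat n n (\<lambda>(i, j). if i = j then ap i else 0)"

definition Lam3 :: "nat \<Rightarrow> (nat \<Rightarrow> real) \<Rightarrow> real mat" where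
  "Lam3 n Rinv = R_const n Rinv \<cdot>\<^sub>m 1\<^sub>m n"

definition Lam4 :: "nat \<Rightarrow> real \<Rightarrow> real mat" where
  "Lam4 n lam = Matrix.mat n n (\<lambda>(i, j). 1 / lam0 lam)"

definition Lam ::
  "nat \<Rightarrow> real \<Rightarrow> (nat \<Rightarrow> real) \<Rightarrow> (nat \<Rightarrow> real) \<Rightarrow> (nat \<Rightarrow> nat \<Rightarrow> real) \<Rightarrow> real mat" where
  "Lam n lam Rinv ap a = Lam1 n a + Lam2 n ap + Lam3 n Rinv + Lam4 n lam"

text \<open>\<open>mat_inverse\<close> is \<open>None\<close> only for singular matrices, and \<open>Lam\<close> is positive definite.\<close>

definition Lam_inv ::
  "nat \<Rightarrow> real \<Rightarrow> (nat \<Rightarrow> real) \<Rightarrow> (nat \<Rightarrow> real) \<Rightarrow> (nat \<Rightarrow> nat \<Rightarrow> real) \<Rightarrow> real mat" where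
  "Lam_inv n lam Rinv ap a = the (mat_inverse (Lam n lam Rinv ap a))"

section \<open>Norms and bilinear form\<close>

definition U_inner ::
  "(real^'d) set \<Rightarrow> real \<Rightarrow> (real^'d \<Rightarrow> real^'d) \<Rightarrow> (real^'d \<Rightarrow> real^'d) \<Rightarrow> real" where
  "U_inner \<Omega> lam u w =
     l2_inner \<Omega> (sym_grad \<Omega> u) (sym_grad \<Omega> w) + lam * l2_inner \<Omega> (div_H1 \<Omega> u) (div_H1 \<Omega> w)"

definition V_inner ::
  "(real^'d) set \<Rightarrow> nat \<Rightarrow> real \<Rightarrow> (nat \<Rightarrow> real) \<Rightarrow> (nat \<Rightarrow> real) \<Rightarrow> (nat \<Rightarrow> nat \<Rightarrow> real) \<Rightarrow>
   (nat \<Rightarrow> real^'d \<Rightarrow> real^'d) \<Rightarrow> (nat \<Rightarrow> real^'d \<Rightarrow> real^'d) \<Rightarrow> real" where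
  "V_inner \<Omega> n lam Rinv ap a v z =
     (\<Sum>i<n. l2_inner \<Omega> (\<lambda>x. Rinv i *\<^sub>R v i x) (z i)) +
     l2_inner_tuple n \<Omega> (mat_apply (Lam_inv n lam Rinv ap a) (Div \<Omega> v)) (Div \<Omega> z)"

definition P_inner ::
  "(real^'d) set \<Rightarrow> nat \<Rightarrow> real \<Rightarrow> (nat \<Rightarrow> real) \<Rightarrow> (nat \<Rightarrow> real) \<Rightarrow> (nat \<Rightarrow> nat \<Rightarrow> real) \<Rightarrow>
   (nat \<Rightarrow> real^'d \<Rightarrow> real) \<Rightarrow> (nat \<Rightarrow> real^'d \<Rightarrow> real) \<Rightarrow> real" where
  "P_inner \<Omega> n lam Rinv ap a p q =
     l2_inner_tuple n \<Omega> (mat_apply (Lam n lam Rinv ap a) p) q"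

definition U_norm :: "(real^'d) set \<Rightarrow> real \<Rightarrow> (real^'d \<Rightarrow> real^'d) \<Rightarrow> real" where
  "U_norm \<Omega> lam u = sqrt (U_inner \<Omega> lam u u)"

definition V_norm ::
  "(real^'d) set \<Rightarrow> nat \<Rightarrow> real \<Rightarrow> (nat \<Rightarrow> real) \<Rightarrow> (nat \<Rightarrow> real) \<Rightarrow> (nat \<Rightarrow> nat \<Rightarrow> real) \<Rightarrow>
   (nat \<Rightarrow> real^'d \<Rightarrow> real^'d) \<Rightarrow> real" where
  "V_norm \<Omega> n lam Rinv ap a v = sqrt (V_inner \<Omega> n lam Rinv ap a v v)"

definition P_norm ::
  "(real^'d) set \<Rightarrow> nat \<Rightarrow> real \<Rightarrow> (nat \<Rightarrow> real) \<Rightarrow> (nat \<Rightarrow> real) \<Rightarrow> (nat \<Rightarrow> nat \<Rightarrow> real) \<Rightarrow>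
   (nat \<Rightarrow> real^'d \<Rightarrow> real) \<Rightarrow> real" where
  "P_norm \<Omega> n lam Rinv ap a p = sqrt (P_inner \<Omega> n lam Rinv ap a p p)"

definition A_form ::
  "(real^'d) set \<Rightarrow> nat \<Rightarrow> real \<Rightarrow> (nat \<Rightarrow> real) \<Rightarrow> (nat \<Rightarrow> real) \<Rightarrow> (nat \<Rightarrow> nat \<Rightarrow> real) \<Rightarrow>
   (real^'d \<Rightarrow> real^'d) \<times> (nat \<Rightarrow> real^'d \<Rightarrow> real^'d) \<times> (nat \<Rightarrow> real^'d \<Rightarrow> real) \<Rightarrow>
   (real^'d \<Rightarrow> real^'d) \<times> (nat \<Rightarrow> real^'d \<Rightarrow> real^'d) \<times> (nat \<Rightarrow> real^'d \<Rightarrow> real) \<Rightarrow> real" where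
  "A_form \<Omega> n lam Rinv ap a = (\<lambda>(u, v, p) (w, z, q).
     l2_inner \<Omega> (sym_grad \<Omega> u) (sym_grad \<Omega> w)
     + lam * l2_inner \<Omega> (div_H1 \<Omega> u) (div_H1 \<Omega> w)
     - l2_inner \<Omega> (\<lambda>x. \<Sum>i<n. p i x) (div_H1 \<Omega> w)
     + (\<Sum>i<n. l2_inner \<Omega> (\<lambda>x. Rinv i *\<^sub>R v i x) (z i))
     - l2_inner_tuple n \<Omega> p (Div \<Omega> z)
     - l2_inner \<Omega> (div_H1 \<Omega> u) (\<lambda>x. \<Sum>i<n. q i x)
     - l2_inner_tuple n \<Omega> (Div \<Omega> v) q
     - l2_inner_tuple n \<Omega> (mat_apply (Lam1 n a + Lam2 n ap) p) q)"

section \<open>Consistency of the two divergences\<close>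

lemma L2_mult_integrable:
  fixes f g :: "real^'d \<Rightarrow> real"
  assumes "f \<in> L2 \<Omega>" "g \<in> L2 \<Omega>"
  shows "integrable (lebesgue_on \<Omega>) (\<lambda>x. f x * g x)"
proof (rule Bochner_Integration.integrable_bound)
  show "integrable (lebesgue_on \<Omega>) (\<lambda>x. (norm (f x))\<^sup>2 + (norm (g x))\<^sup>2)"
    using assms by (auto simp: L2_def)
  show "(\<lambda>x. f x * g x) \<in> borel_measurable (lebesgue_on \<Omega>)"
    using assms by (auto simp: L2_def)
  have "\<bar>f x * g x\<bar> \<le> (f x)\<^sup>2 + (g x)\<^sup>2" for x
  proof -
    have "2 * (\<bar>f x\<bar> * \<bar>g x\<bar>) \<le> (f x)\<^sup>2 + (g x)\<^sup>2"
      using sum_squares_bound[of "\<bar>f x\<bar>" "\<bar>g x\<bar>"] by simp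
    moreover have "0 \<le> \<bar>f x\<bar> * \<bar>g x\<bar>" by simp
    ultimately show ?thesis unfolding abs_mult by linarith
  qed
  then show "AE x in lebesgue_on \<Omega>. norm (f x * g x) \<le> norm ((norm (f x))\<^sup>2 + (norm (g x))\<^sup>2)"
    by (intro AE_I2) simp
qed

lemma continuous_compact_support_L2:
  fixes f :: "real^'d \<Rightarrow> real"
  assumes cont: "continuous_on UNIV f" and K: "compact K" "\<And>x. x \<notin> K \<Longrightarrow> f x = 0"
    and \<Omega>: "\<Omega> \<in> sets lebesgue"
  shows "f \<in> L2 \<Omega>"
proof -
  have meas: "f \<in> borel_measurable (lebesgue_on \<Omega>)"
    using borel_measurable_continuous_onI[OF cont]
    by (intro measurable_restrict_space1 measurable_completion) simp
  have "compact (f ` K)"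
    using cont K by (meson compact_continuous_image continuous_on_subset subset_UNIV)
  then obtain B where B: "\<And>x. x \<in> K \<Longrightarrow> \<bar>f x\<bar> \<le> B"
    using compact_imp_bounded[of "f ` K"] by (auto simp: bounded_iff)
  have "integrable lebesgue (indicator K :: _ \<Rightarrow> real)"
    using lmeasurable_compact[OF K(1)]
    by (intro integrable_real_indicator) (auto simp: fmeasurable_def)
  then have "integrable lebesgue (\<lambda>x. indicator \<Omega> x *\<^sub>R (B\<^sup>2 * indicator K x))"
    using \<Omega> by (intro integrable_mult_indicator integrable_mult_right) auto
  then have int: "integrable (lebesgue_on \<Omega>) (\<lambda>x. B\<^sup>2 * indicator K x)"
    using \<Omega> by (subst integrable_restrict_space) auto
  have "integrable (lebesgue_on \<Omega>) (\<lambda>x. (norm (f x))\<^sup>2)"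
  proof (rule Bochner_Integration.integrable_bound[OF int])
    show "(\<lambda>x. (norm (f x))\<^sup>2) \<in> borel_measurable (lebesgue_on \<Omega>)"
      using meas by simp
    have "(f x)\<^sup>2 \<le> B\<^sup>2 * indicator K x" for x
      using B[of x] K(2)[of x] abs_le_square_iff[of "f x" B] by (cases "x \<in> K") auto
    then show "AE x in lebesgue_on \<Omega>. norm ((norm (f x))\<^sup>2) \<le> norm (B\<^sup>2 * indicator K x)"
      by (intro AE_I2) simp
  qed
  with meas show ?thesis by (simp add: L2_def)
qed

lemma test_function_L2:
  assumes "\<phi> \<in> test_functions \<Omega>" "open \<Omega>"
  shows "\<phi> \<in> L2 \<Omega>" "partial_deriv i \<phi> \<in> L2 \<Omega>"
proof -
  let ?K = "closure {x. \<phi> x \<noteq> 0}"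
  have sm: "smooth \<phi>" and K: "compact ?K"
    using assms(1) by (auto simp: test_functions_def)
  have d0: "\<phi> differentiable (at x)" and d1: "partial_deriv i \<phi> differentiable (at x)" for x
    using sm[unfolded smooth_def, rule_format, of "[]" x]
      sm[unfolded smooth_def, rule_format, of "[i]" x] by simp_all
  have \<Omega>: "\<Omega> \<in> sets lebesgue" using assms(2) by simp
  show "\<phi> \<in> L2 \<Omega>"
  proof (rule continuous_compact_support_L2[OF _ K _ \<Omega>])
    show "continuous_on UNIV \<phi>"
      using d0 by (simp add: continuous_on_eq_continuous_at differentiable_imp_continuous_within)
    show "\<phi> x = 0" if "x \<notin> ?K" for x using that closure_subset[of "{x. \<phi> x \<noteq> 0}"] by auto
  qed
  show "partial_deriv i \<phi> \<in> L2 \<Omega>"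
  proof (rule continuous_compact_support_L2[OF _ K _ \<Omega>])
    show "continuous_on UNIV (partial_deriv i \<phi>)"
      using d1 by (simp add: continuous_on_eq_continuous_at differentiable_imp_continuous_within)
    fix x assume x: "x \<notin> ?K"
    have "(\<phi> has_derivative (\<lambda>h. 0)) (at x)"
    proof (rule has_derivative_transform_within_open[of "\<lambda>_. 0" _ _ _ "- ?K"])
      show "0 = \<phi> y" if "y \<in> - ?K" for y using that closure_subset[of "{x. \<phi> x \<noteq> 0}"] by auto
    qed (use x in auto)
    then show "partial_deriv i \<phi> x = 0"
      unfolding partial_deriv_def by (simp add: frechet_derivative_at[symmetric])
  qed
qed

lemma weak_partial_H1:
  assumes "f \<in> H1 \<Omega>"
  shows "weak_partial \<Omega> i f \<in> L2 \<Omega>" "has_weak_partial \<Omega> i f (weak_partial \<Omega> i f)"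
proof -
  have "\<exists>g. g \<in> L2 \<Omega> \<and> has_weak_partial \<Omega> i f g"
    using assms by (auto simp: H1_def)
  from someI_ex[OF this] show "weak_partial \<Omega> i f \<in> L2 \<Omega>"
    "has_weak_partial \<Omega> i f (weak_partial \<Omega> i f)"
    by (simp_all add: weak_partial_def)
qed

lemma has_weak_div_div_H1:
  assumes "open \<Omega>" and u: "\<And>i. (\<lambda>x. u x $ i) \<in> H1 \<Omega>"
  shows "has_weak_div \<Omega> u (div_H1 \<Omega> u)"
  unfolding has_weak_div_def
proof
  fix \<phi> assume \<phi>: "\<phi> \<in> test_functions \<Omega>"
  note L = test_function_L2[OF \<phi> assms(1)]
  have uL: "(\<lambda>x. u x $ i) \<in> L2 \<Omega>" for i using u by (simp add: H1_def)
  have "l2_inner \<Omega> u (\<lambda>x. \<chi> i. partial_deriv i \<phi> x) =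
      (\<Sum>i\<in>UNIV. LINT x|lebesgue_on \<Omega>. u x $ i * partial_deriv i \<phi> x)"
    unfolding l2_inner_def inner_vec_def
    by (simp add: Bochner_Integration.integral_sum L2_mult_integrable[OF uL L(2)])
  also have "\<dots> = (\<Sum>i\<in>UNIV. - (LINT x|lebesgue_on \<Omega>. weak_partial \<Omega> i (\<lambda>y. u y $ i) x * \<phi> x))"
    using weak_partial_H1(2)[OF u] \<phi>
    by (intro sum.cong) (auto simp: has_weak_partial_def l2_inner_def)
  also have "\<dots> = - l2_inner \<Omega> (div_H1 \<Omega> u) \<phi>"
    unfolding l2_inner_def div_H1_def
    by (simp add: sum_distrib_right sum_negf Bochner_Integration.integral_sum
        L2_mult_integrable[OF weak_partial_H1(1)[OF u] L(1)])
  finally show "l2_inner \<Omega> u (\<lambda>x. \<chi> i. partial_deriv i \<phi> x) = - l2_inner \<Omega> (div_H1 \<Omega> u) \<phi>" .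
qed

end

theory Submission
  imports Defs "Jordan_Normal_Form.Determinant"
begin

no_notation Matrix.vec_index (infixl "$" 100)
no_notation Matrix.scalar_prod (infix "\<bullet>" 70)

text \<open>
  The constant is \<open>C\<^sub>b = 2\<close>. Every term of the form is the integral of a pointwise expression
  obeying a Cauchy-Schwarz inequality in the energy densities, and this passes to the integrals.
  The pressure-flux coupling is the duality between \<open>\<Lambda>\<close> and \<open>\<Lambda>\<^sup>-\<^sup>1\<close>; the exchange term is
  controlled because \<open>\<Lambda>\<^sub>3\<close> and \<open>\<Lambda>\<^sub>4\<close> are positive semidefinite. The pressure-displacement coupling is
  where \<open>\<Lambda>\<^sub>4\<close> enters: \<open>(\<Sum>\<^sub>i p\<^sub>i)\<^sup>2 \<le> \<lambda>\<^sub>0 (\<Lambda> p \<bullet> p)\<close> holds independently of \<open>n\<close>, while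
  \<open>\<lambda>\<^sub>0 (div u)\<^sup>2 \<le> (1 + \<lambda>) (div u)\<^sup>2 \<le> d |\<epsilon>(u)|\<^sup>2 + \<lambda> (div u)\<^sup>2\<close>, with \<open>d \<le> 3\<close>.
\<close>

section \<open>Cauchy-Schwarz from a pointwise bound\<close>

text \<open>The right side of \<open>bound\<close> has minimum 2 sqrt (a b) over t, attained at t =
  sqrt (b / a). A zero a or b has no such t, so both are first raised by e > 0 and then e tends to
  0. The gain is that the hypothesis is linear in a and b, hence stable under sums and
  integrals.\<close>

lemma le_sqrt_mult_sqrtI:
  fixes a b c :: real
  assumes nonneg: "0 \<le> a" "0 \<le> b" and bound: "\<And>t. t > 0 \<Longrightarrow> 2 * c \<le> t * a + b / t"
  shows "c \<le> sqrt a * sqrt b"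
proof (rule tendsto_lowerbound)
  show "((\<lambda>e. sqrt (a + e) * sqrt (b + e)) \<longlongrightarrow> sqrt a * sqrt b) (at_right 0)"
    by (auto intro!: tendsto_eq_intros)
  have "c \<le> sqrt (a + e) * sqrt (b + e)" if e: "e > 0" for e
  proof -
    let ?r = "sqrt (a + e)" and ?s = "sqrt (b + e)"
    have pos: "?r > 0" "?s > 0" using e nonneg by auto
    have sq: "a + e = ?r * ?r" "b + e = ?s * ?s" using e nonneg by auto
    \<comment> \<open>This weight t is the minimiser for the perturbed pair a + e, b + e.\<close>
    have "2 * c \<le> (?s / ?r) * a + b / (?s / ?r)"
      using pos by (intro bound) simp
    also have "\<dots> \<le> (?s / ?r) * (a + e) + (b + e) / (?s / ?r)"
      using e pos by (intro add_mono mult_left_mono divide_right_mono) auto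
    also have "\<dots> = (?s / ?r) * (?r * ?r) + (?s * ?s) / (?s / ?r)"
      using sq by metis
    also have "\<dots> = 2 * (?r * ?s)" using pos by (simp add: field_simps)
    finally show ?thesis by simp
  qed
  then show "\<forall>\<^sub>F e in at_right 0. c \<le> sqrt (a + e) * sqrt (b + e)"
    by (auto simp: eventually_at_right_less intro: eventually_mono[OF eventually_at_right_less])
qed simp

lemma two_mult_le_weighted_squares:
  fixes x y t :: real
  assumes "t > 0"
  shows "2 * (x * y) \<le> t * x\<^sup>2 + y\<^sup>2 / t"
proof -
  have "0 \<le> (t * x - y)\<^sup>2 / t" using assms by simp
  also have "\<dots> = t * x\<^sup>2 + y\<^sup>2 / t - 2 * (x * y)"
    using assms by (simp add: power2_eq_square field_simps)
  finally show ?thesis by simp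
qed

text \<open>If \<open>F\<close> is not integrable, its integral is \<open>0\<close> by convention.\<close>

lemma integral_abs_le_sqrt_mult_sqrt:
  fixes F a b :: "'a \<Rightarrow> real"
  assumes int: "integrable M a" "integrable M b"
    and nonneg: "\<And>x. 0 \<le> a x" "\<And>x. 0 \<le> b x"
    and bound: "\<And>x. \<bar>F x\<bar> \<le> sqrt (a x) * sqrt (b x)"
  shows "\<bar>LINT x|M. F x\<bar> \<le> sqrt (LINT x|M. a x) * sqrt (LINT x|M. b x)"
proof (rule le_sqrt_mult_sqrtI)
  show "0 \<le> (LINT x|M. a x)" "0 \<le> (LINT x|M. b x)"
    using nonneg by simp_all
  fix t :: real assume t: "t > 0"
  \<comment> \<open>Young's inequality with a weight t that does not vary with x makes the bound
    linear in \<open>a x\<close> and \<open>b x\<close>, so that it can be integrated.\<close>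
  have pt: "2 * \<bar>F x\<bar> \<le> t * a x + b x / t" for x
    using two_mult_le_weighted_squares[OF t, of "sqrt (a x)" "sqrt (b x)"] bound[of x] nonneg
    by simp
  have R: "(LINT x|M. t * a x + b x / t) = t * (LINT x|M. a x) + (LINT x|M. b x) / t"
    using int by simp
  have "2 * \<bar>LINT x|M. F x\<bar> \<le> (LINT x|M. t * a x + b x / t)"
  proof (cases "integrable M F")
    case True
    have "2 * \<bar>LINT x|M. F x\<bar> \<le> 2 * (LINT x|M. \<bar>F x\<bar>)"
      by (simp add: integral_abs_bound)
    also have "\<dots> = (LINT x|M. 2 * \<bar>F x\<bar>)" by simp
    also have "\<dots> \<le> (LINT x|M. t * a x + b x / t)"
      using True int pt by (intro integral_mono) auto
    finally show ?thesis .
  next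
    case False
    then show ?thesis
      using pt by (auto simp: not_integrable_integral_eq intro!: integral_nonneg_AE AE_I2
          order.trans[OF _ pt])
  qed
  then show "2 * \<bar>LINT x|M. F x\<bar> \<le> t * (LINT x|M. a x) + (LINT x|M. b x) / t"
    using R by simp
qed

section \<open>Square-integrable functions\<close>

lemma L2_inner_integrable:
  fixes f g :: "real^'d \<Rightarrow> 'b::euclidean_space"
  assumes "f \<in> L2 \<Omega>" "g \<in> L2 \<Omega>"
  shows "integrable (lebesgue_on \<Omega>) (\<lambda>x. inner (f x) (g x))"
proof (rule Bochner_Integration.integrable_bound)
  show "integrable (lebesgue_on \<Omega>) (\<lambda>x. (norm (f x))\<^sup>2 + (norm (g x))\<^sup>2)"
    using assms by (auto simp: L2_def)
  show "(\<lambda>x. inner (f x) (g x)) \<in> borel_measurable (lebesgue_on \<Omega>)"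
    using assms by (auto simp: L2_def)
  have "\<bar>inner (f x) (g x)\<bar> \<le> (norm (f x))\<^sup>2 + (norm (g x))\<^sup>2" for x
  proof -
    have "2 * (norm (f x) * norm (g x)) \<le> (norm (f x))\<^sup>2 + (norm (g x))\<^sup>2"
      using sum_squares_bound[of "norm (f x)" "norm (g x)"] by simp
    moreover have "0 \<le> norm (f x) * norm (g x)" by simp
    ultimately show ?thesis using Cauchy_Schwarz_ineq2[of "f x" "g x"] by linarith
  qed
  then show "AE x in lebesgue_on \<Omega>. norm (inner (f x) (g x)) \<le> norm ((norm (f x))\<^sup>2 + (norm (g x))\<^sup>2)"
    by (intro AE_I2) simp
qed

lemma L2_add:
  fixes f g :: "real^'d \<Rightarrow> real"
  assumes f: "f \<in> L2 \<Omega>" and g: "g \<in> L2 \<Omega>"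
  shows "(\<lambda>x. f x + g x) \<in> L2 \<Omega>"
proof -
  have "(norm (f x + g x))\<^sup>2 = f x * f x + 2 * (f x * g x) + g x * g x" for x
    by (simp add: power2_eq_square algebra_simps)
  then show ?thesis
    using f g L2_mult_integrable[OF f f] L2_mult_integrable[OF g g] L2_mult_integrable[OF f g]
    by (auto simp: L2_def)
qed

lemma L2_mult_left:
  fixes f :: "real^'d \<Rightarrow> real"
  assumes "f \<in> L2 \<Omega>"
  shows "(\<lambda>x. c * f x) \<in> L2 \<Omega>"
  using assms by (auto simp: L2_def power_mult_distrib)

lemma L2_sum:
  fixes f :: "'i \<Rightarrow> real^'d \<Rightarrow> real"
  assumes "\<And>i. i \<in> I \<Longrightarrow> f i \<in> L2 \<Omega>"
  shows "(\<lambda>x. \<Sum>i\<in>I. f i x) \<in> L2 \<Omega>"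
  using assms
proof (induction I rule: infinite_finite_induct)
  case (insert i I)
  then show ?case using L2_add[of "f i" \<Omega> "\<lambda>x. \<Sum>i\<in>I. f i x"] by simp
qed (auto simp: L2_def)

lemma H10_vec_weak_partial_L2:
  assumes "u \<in> H10_vec \<Omega>"
  shows "weak_partial \<Omega> j (\<lambda>y. u y $ i) \<in> L2 \<Omega>"
  using assms by (intro weak_partial_H1) (auto simp: H10_vec_def H10_def)

lemma div_H1_L2: "u \<in> H10_vec \<Omega> \<Longrightarrow> div_H1 \<Omega> u \<in> L2 \<Omega>"
  unfolding div_H1_def[abs_def] by (intro L2_sum H10_vec_weak_partial_L2)

text \<open>Entries reduce integrability of the Frobenius product to scalar L2 products; the
  diagonal entries are exactly the summands of \<open>div_H1\<close>.\<close>

lemma sym_grad_nth: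
  "sym_grad \<Omega> u x $ i $ j =
     1/2 * (weak_partial \<Omega> j (\<lambda>y. u y $ i) x + weak_partial \<Omega> i (\<lambda>y. u y $ j) x)"
  by (simp add: sym_grad_def weak_jacobian_def weak_grad_def transpose_def)

lemma sym_grad_nth_L2:
  assumes "u \<in> H10_vec \<Omega>"
  shows "(\<lambda>x. sym_grad \<Omega> u x $ i $ j) \<in> L2 \<Omega>"
  unfolding sym_grad_nth by (intro L2_mult_left L2_add H10_vec_weak_partial_L2 assms)

lemma sym_grad_inner_integrable:
  assumes "u \<in> H10_vec \<Omega>" "w \<in> H10_vec \<Omega>"
  shows "integrable (lebesgue_on \<Omega>) (\<lambda>x. inner (sym_grad \<Omega> u x) (sym_grad \<Omega> w x))"
  unfolding inner_vec_def inner_real_def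
  by (intro Bochner_Integration.integrable_sum L2_mult_integrable sym_grad_nth_L2 assms)

text \<open>The divergence is the trace of the symmetric gradient, and a trace is at most
  \<open>\<surd>d\<close> times the Frobenius norm.\<close>

lemma div_H1_square_le:
  fixes u :: "real^'d \<Rightarrow> real^'d"
  shows "(div_H1 \<Omega> u x)\<^sup>2 \<le> CARD('d) * inner (sym_grad \<Omega> u x) (sym_grad \<Omega> u x)"
proof -
  let ?e = "sym_grad \<Omega> u x"
  \<comment> \<open>The factor 1 is written out for Cauchy-Schwarz: its squares sum to the dimension
    d.\<close>
  have "(div_H1 \<Omega> u x)\<^sup>2 = (\<Sum>i\<in>UNIV. 1 * ?e $ i $ i)\<^sup>2"
    by (simp add: div_H1_def sym_grad_nth)
  also have "\<dots> \<le> (\<Sum>i\<in>(UNIV::'d set). 1\<^sup>2) * (\<Sum>i\<in>UNIV. (?e $ i $ i)\<^sup>2)"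
    by (rule Cauchy_Schwarz_ineq_sum)
  also have "\<dots> \<le> CARD('d) * (\<Sum>i\<in>UNIV. \<Sum>j\<in>UNIV. (?e $ i $ j)\<^sup>2)"
  proof -
    have "(?e $ i $ i)\<^sup>2 \<le> (\<Sum>j\<in>UNIV. (?e $ i $ j)\<^sup>2)" for i
      by (rule member_le_sum) auto
    then show ?thesis by (auto intro!: mult_left_mono sum_mono)
  qed
  also have "\<dots> = CARD('d) * inner ?e ?e"
    by (simp add: inner_vec_def power2_eq_square)
  finally show ?thesis .
qed

text \<open>\<open>weak_div\<close> is a choice; membership in \<open>Hdiv\<close> supplies the
  witness that makes the chosen function an L2 function.\<close>

lemma V_space_L2:
  assumes "v \<in> V_space n \<Omega>" "i < n"
  shows "v i \<in> L2 \<Omega>" "Div \<Omega> v i \<in> L2 \<Omega>"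
proof -
  have "v i \<in> Hdiv \<Omega>"
    using assms by (auto simp: V_space_def H0div_def)
  then have "v i \<in> L2 \<Omega>" and ex: "\<exists>g. g \<in> L2 \<Omega> \<and> has_weak_div \<Omega> (v i) g"
    by (auto simp: Hdiv_def)
  then show "v i \<in> L2 \<Omega>" "Div \<Omega> v i \<in> L2 \<Omega>"
    using someI_ex[OF ex] by (simp_all add: Div_def weak_div_def)
qed

lemma P_space_L2: "p \<in> P_space n \<Omega> \<Longrightarrow> i < n \<Longrightarrow> p i \<in> L2 \<Omega>"
  by (auto simp: P_space_def L20_def)

section \<open>Bilinear forms of matrices\<close>

text \<open>Vectors are functions on indices, so the values \<open>\<lambda>i. p i x\<close> of a
  tuple at one point can be inserted directly; the inner sum has the shape of
  \<open>mat_apply\<close>.\<close>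

definition mat_form :: "real mat \<Rightarrow> (nat \<Rightarrow> real) \<Rightarrow> (nat \<Rightarrow> real) \<Rightarrow> real" where
  "mat_form M x y = (\<Sum>i<dim_row M. (\<Sum>j<dim_col M. M $$ (i, j) * x j) * y i)"

lemma mat_form_carrier:
  assumes "M \<in> carrier_mat n n"
  shows "mat_form M x y = (\<Sum>i<n. \<Sum>j<n. M $$ (i, j) * x j * y i)"
  using assms by (simp add: mat_form_def sum_distrib_right)

lemma mat_form_add:
  assumes "A \<in> carrier_mat n n" "B \<in> carrier_mat n n"
  shows "mat_form (A + B) x y = mat_form A x y + mat_form B x y"
  using assms
  by (simp add: mat_form_carrier[of _ n] sum.distrib[symmetric] algebra_simps)

lemma mat_form_commute:
  assumes "M \<in> carrier_mat n n" "\<And>i j. i < n \<Longrightarrow> j < n \<Longrightarrow> M $$ (i, j) = M $$ (j, i)"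
  shows "mat_form M x y = mat_form M y x"
proof -
  have "mat_form M x y = (\<Sum>j<n. \<Sum>i<n. M $$ (i, j) * x j * y i)"
    unfolding mat_form_carrier[OF assms(1)] by (rule sum.swap)
  also have "\<dots> = mat_form M y x"
    unfolding mat_form_carrier[OF assms(1)] using assms(2)
    by (intro sum.cong) auto
  finally show ?thesis .
qed

text \<open>The form is nonnegative at t x + y and t x - y; expanding and dividing by t gives the
  hypothesis of \<open>le_sqrt_mult_sqrtI\<close>. Semidefiniteness suffices, which matters for
  \<Lambda>1 + \<Lambda>2.\<close>

lemma mat_form_Cauchy_Schwarz:
  assumes M: "M \<in> carrier_mat n n"
    and sym: "\<And>i j. i < n \<Longrightarrow> j < n \<Longrightarrow> M $$ (i, j) = M $$ (j, i)"
    and psd: "\<And>x. 0 \<le> mat_form M x x"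
  shows "\<bar>mat_form M x y\<bar> \<le> sqrt (mat_form M x x) * sqrt (mat_form M y y)"
proof (rule le_sqrt_mult_sqrtI[OF psd psd])
  fix t :: real assume t: "t > 0"
  have expand: "mat_form M (\<lambda>i. t * x i + s * y i) (\<lambda>i. t * x i + s * y i) =
      t\<^sup>2 * mat_form M x x + 2 * t * s * mat_form M x y + s\<^sup>2 * mat_form M y y" for s
  proof -
    have "mat_form M (\<lambda>i. t * x i + s * y i) (\<lambda>i. t * x i + s * y i) =
      t\<^sup>2 * mat_form M x x + t * s * mat_form M x y + t * s * mat_form M y x + s\<^sup>2 * mat_form M y y"
      unfolding mat_form_carrier[OF M] sum_distrib_left sum.distrib[symmetric]
      by (intro sum.cong refl) (simp add: power2_eq_square algebra_simps)
    then show ?thesis using mat_form_commute[OF M sym, of y x] by simp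
  qed
  have "0 \<le> t\<^sup>2 * mat_form M x x + 2 * t * s * mat_form M x y + s\<^sup>2 * mat_form M y y" for s
    using psd[of "\<lambda>i. t * x i + s * y i"] expand by simp
  \<comment> \<open>The two signs of s bound the mixed term from both sides, hence its absolute
    value.\<close>
  from this[of 1] this[of "-1"]
  have "2 * t * \<bar>mat_form M x y\<bar> \<le> t\<^sup>2 * mat_form M x x + mat_form M y y"
    by (simp add: abs_if)
  then show "2 * \<bar>mat_form M x y\<bar> \<le> t * mat_form M x x + mat_form M y y / t"
    using t by (simp add: field_simps power2_eq_square)
qed

lemma l2_inner_tuple_eq:
  assumes "\<And>i. i < n \<Longrightarrow> p i \<in> L2 \<Omega>" "\<And>i. i < n \<Longrightarrow> q i \<in> L2 \<Omega>"
  shows "l2_inner_tuple n \<Omega> p q = (LINT x|lebesgue_on \<Omega>. (\<Sum>i<n. p i x * q i x))"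
  unfolding l2_inner_tuple_def l2_inner_def inner_real_def
  by (subst Bochner_Integration.integral_sum) (auto intro!: L2_mult_integrable assms)

lemma mat_apply_L2:
  assumes "\<And>i. i < dim_col M \<Longrightarrow> p i \<in> L2 \<Omega>"
  shows "mat_apply M p i \<in> L2 \<Omega>"
  unfolding mat_apply_def[abs_def] by (intro L2_sum L2_mult_left assms) simp

text \<open>Bridge from L2 forms to pointwise algebra: matrix inequalities are proved for real
  vectors at each x and then integrated.\<close>

lemma l2_inner_tuple_mat_apply:
  assumes M: "M \<in> carrier_mat n n"
    and "\<And>i. i < n \<Longrightarrow> p i \<in> L2 \<Omega>" "\<And>i. i < n \<Longrightarrow> q i \<in> L2 \<Omega>"
  shows "l2_inner_tuple n \<Omega> (mat_apply M p) q =
    (LINT x|lebesgue_on \<Omega>. mat_form M (\<lambda>i. p i x) (\<lambda>i. q i x))"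
  using M assms(2,3)
  by (subst l2_inner_tuple_eq) (auto intro: mat_apply_L2 simp: mat_form_def mat_apply_def)

lemma mat_form_integrable:
  assumes M: "M \<in> carrier_mat n n"
    and "\<And>i. i < n \<Longrightarrow> p i \<in> L2 \<Omega>" "\<And>i. i < n \<Longrightarrow> q i \<in> L2 \<Omega>"
  shows "integrable (lebesgue_on \<Omega>) (\<lambda>x. mat_form M (\<lambda>i. p i x) (\<lambda>i. q i x))"
  using L2_mult_integrable[OF mat_apply_L2[of M p \<Omega>]] assms
  by (auto simp: mat_form_def mat_apply_def intro!: Bochner_Integration.integrable_sum)

section \<open>The parameter matrices\<close>

lemma parameter_mat_carrier [simp]:
  "Lam1 n a \<in> carrier_mat n n" "Lam2 n ap \<in> carrier_mat n n" "Lam3 n Rinv \<in> carrier_mat n n"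
  "Lam4 n lam \<in> carrier_mat n n" "Lam n lam Rinv ap a \<in> carrier_mat n n"
  by (simp_all add: Lam1_def Lam2_def Lam3_def Lam4_def Lam_def)

lemma mat_form_Lam:
  "mat_form (Lam n lam Rinv ap a) x y =
     mat_form (Lam1 n a + Lam2 n ap) x y + mat_form (Lam3 n Rinv) x y + mat_form (Lam4 n lam) x y"
  unfolding Lam_def by (simp add: mat_form_add[of _ n])

text \<open>In the variables \<open>x\<^sub>i / \<alpha>\<^sub>i\<close> this matrix is the Laplacian of the graph with edge
  weights \<open>\<tau> \<beta>\<^sub>i\<^sub>j\<close>.\<close>

lemma Lam1_psd:
  assumes "admissible n lam Rinv ap a"
  shows "0 \<le> mat_form (Lam1 n a) x x"
proof -
  from assms obtain \<tau> \<alpha> \<beta> where \<tau>: "\<tau> > 0" and \<alpha>: "\<forall>i<n. \<alpha> i > 0"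
    and \<beta>: "\<forall>i<n. \<forall>j<n. i \<noteq> j \<longrightarrow> \<beta> i j = \<beta> j i \<and> \<beta> i j \<ge> 0"
    and \<beta>d: "\<forall>i<n. \<beta> i i = (\<Sum>j\<in>{..<n} - {i}. \<beta> i j)"
    and a: "\<forall>i<n. \<forall>j<n. a i j = \<tau> * \<beta> i j / (\<alpha> i * \<alpha> j)"
    unfolding admissible_def by (elim conjE exE) metis
  define y where "y i = x i / \<alpha> i" for i
  \<comment> \<open>The diagonal is set to zero because \<open>\<beta> i i\<close> is the degree of
    vertex i, not the weight of an edge.\<close>
  define w where "w i j = (if i = j then 0 else \<tau> * \<beta> i j)" for i j
  have w: "w i j = w j i" "0 \<le> w i j" if "i < n" "j < n" for i j
    using that \<tau> \<beta> by (auto simp: w_def)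
  have row: "(\<Sum>j<n. Lam1 n a $$ (i, j) * x j * x i) = (\<Sum>j<n. w i j * ((y i)\<^sup>2 - y i * y j))"
    if i: "i < n" for i
  proof -
    have "(\<Sum>j<n. Lam1 n a $$ (i, j) * x j * x i) =
        Lam1 n a $$ (i, i) * x i * x i + (\<Sum>j\<in>{..<n} - {i}. Lam1 n a $$ (i, j) * x j * x i)"
      using i by (simp add: sum.remove)
    \<comment> \<open>The degree relation \<open>\<beta>d\<close> spreads the diagonal entry over
      the edges at i, so that it pairs with the off-diagonal entries edge by edge.\<close>
    also have "Lam1 n a $$ (i, i) * x i * x i = (\<Sum>j\<in>{..<n} - {i}. w i j * (y i)\<^sup>2)"
    proof -
      have "Lam1 n a $$ (i, i) * x i * x i = \<tau> * \<beta> i i * (y i)\<^sup>2"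
        using i a by (simp add: Lam1_def y_def power2_eq_square)
      also have "\<dots> = (\<Sum>j\<in>{..<n} - {i}. \<tau> * \<beta> i j * (y i)\<^sup>2)"
        using i \<beta>d by (metis sum_distrib_left sum_distrib_right)
      also have "\<dots> = (\<Sum>j\<in>{..<n} - {i}. w i j * (y i)\<^sup>2)"
        by (intro sum.cong) (auto simp: w_def)
      finally show ?thesis .
    qed
    also have "(\<Sum>j\<in>{..<n} - {i}. Lam1 n a $$ (i, j) * x j * x i) =
        (\<Sum>j\<in>{..<n} - {i}. - (w i j * (y i * y j)))"
      using i a by (intro sum.cong) (auto simp: Lam1_def y_def w_def)
    also have "(\<Sum>j\<in>{..<n} - {i}. w i j * (y i)\<^sup>2) + (\<Sum>j\<in>{..<n} - {i}. - (w i j * (y i * y j))) =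
        (\<Sum>j\<in>{..<n} - {i}. w i j * ((y i)\<^sup>2 - y i * y j))"
      by (simp add: sum.distrib[symmetric] algebra_simps)
    also have "\<dots> = (\<Sum>j<n. w i j * ((y i)\<^sup>2 - y i * y j))"
      using i by (simp add: sum.remove[of "{..<n}" i] w_def)
    finally show ?thesis .
  qed
  define S where "S = (\<Sum>i<n. \<Sum>j<n. w i j * ((y i)\<^sup>2 - y i * y j))"
  \<comment> \<open>Symmetrisation: S with the roles of i and j exchanged, added to S, completes the
    squares \<open>(y i - y j)\<^sup>2\<close>.\<close>
  have "S = (\<Sum>j<n. \<Sum>i<n. w i j * ((y i)\<^sup>2 - y i * y j))"
    unfolding S_def by (rule sum.swap)
  also have "\<dots> = (\<Sum>i<n. \<Sum>j<n. w i j * ((y j)\<^sup>2 - y i * y j))"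
    using w by (intro sum.cong refl) (simp add: mult.commute)
  finally have "2 * S = (\<Sum>i<n. \<Sum>j<n. w i j * ((y j)\<^sup>2 - y i * y j)) + S"
    by simp
  also have "\<dots> = (\<Sum>i<n. \<Sum>j<n. w i j * (y i - y j)\<^sup>2)"
    unfolding S_def sum.distrib[symmetric]
    by (intro sum.cong refl) (simp add: power2_eq_square algebra_simps)
  also have "\<dots> \<ge> 0"
    using w by (intro sum_nonneg) auto
  finally have "0 \<le> S" by simp
  then show ?thesis
    using row by (simp add: mat_form_carrier[of _ n] S_def)
qed

lemma Lam2_psd:
  assumes "admissible n lam Rinv ap a"
  shows "0 \<le> mat_form (Lam2 n ap) x x"
  using assms
  by (auto simp: mat_form_carrier[of _ n] Lam2_def admissible_def mult.assoc if_distrib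
      cong: if_cong intro!: sum_nonneg)

lemma Lam12_psd:
  assumes "admissible n lam Rinv ap a"
  shows "0 \<le> mat_form (Lam1 n a + Lam2 n ap) x x"
  using Lam1_psd[OF assms] Lam2_psd[OF assms] by (simp add: mat_form_add[of _ n])

lemma mat_form_Lam3: "mat_form (Lam3 n Rinv) x x = R_const n Rinv * (\<Sum>i<n. (x i)\<^sup>2)"
proof -
  have "mat_form (Lam3 n Rinv) x x =
      (\<Sum>i<n. \<Sum>j<n. if i = j then R_const n Rinv * (x j)\<^sup>2 else 0)"
    unfolding mat_form_carrier[OF parameter_mat_carrier(3)]
    by (intro sum.cong) (auto simp: Lam3_def power2_eq_square)
  then show ?thesis by (simp add: sum_distrib_left)
qed

lemma mat_form_Lam4: "mat_form (Lam4 n lam) x x = (\<Sum>i<n. x i)\<^sup>2 / lam0 lam"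
proof -
  have "mat_form (Lam4 n lam) x x = (\<Sum>i<n. \<Sum>j<n. x i * x j / lam0 lam)"
    unfolding mat_form_carrier[OF parameter_mat_carrier(4)]
    by (intro sum.cong) (auto simp: Lam4_def)
  then show ?thesis
    by (simp add: power2_eq_square sum_product sum_divide_distrib)
qed

lemma R_const_pos:
  assumes "admissible n lam Rinv ap a" "n \<ge> 1"
  shows "R_const n Rinv > 0"
proof -
  \<comment> \<open>Since n \<ge> 1 the set is nonempty, so the maximum is one of the positive
    values \<open>Rinv i\<close>.\<close>
  have "Max (Rinv ` {..<n}) \<in> Rinv ` {..<n}"
    using assms(2) by (intro Max_in) (auto simp: lessThan_empty_iff)
  then show ?thesis
    using assms(1) by (auto simp: R_const_def admissible_def)
qed

text \<open>\<Lambda>1 + \<Lambda>2, \<Lambda>3 and \<Lambda>4 each have a nonnegative form, so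
  dropping any of them bounds \<Lambda> from below. The first bound serves the exchange term, the
  second the coupling to the displacement, the third the invertibility of \<Lambda>.\<close>

lemma Lam_bounds:
  assumes "admissible n lam Rinv ap a" "n \<ge> 1"
  shows "mat_form (Lam1 n a + Lam2 n ap) x x \<le> mat_form (Lam n lam Rinv ap a) x x"
    and "(\<Sum>i<n. x i)\<^sup>2 \<le> lam0 lam * mat_form (Lam n lam Rinv ap a) x x"
    and "R_const n Rinv * (\<Sum>i<n. (x i)\<^sup>2) \<le> mat_form (Lam n lam Rinv ap a) x x"
    and "0 \<le> mat_form (Lam n lam Rinv ap a) x x"
proof -
  have 1: "0 \<le> mat_form (Lam1 n a + Lam2 n ap) x x"
    by (rule Lam12_psd[OF assms(1)])
  have 3: "0 \<le> R_const n Rinv * (\<Sum>i<n. (x i)\<^sup>2)"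
    using R_const_pos[OF assms] by (simp add: sum_nonneg)
  have l: "lam0 lam > 0" by (simp add: lam0_def)
  then have 4: "0 \<le> (\<Sum>i<n. x i)\<^sup>2 / lam0 lam" by simp
  note eq = mat_form_Lam[of n lam Rinv ap a x x] mat_form_Lam3 mat_form_Lam4
  show "mat_form (Lam1 n a + Lam2 n ap) x x \<le> mat_form (Lam n lam Rinv ap a) x x"
    "R_const n Rinv * (\<Sum>i<n. (x i)\<^sup>2) \<le> mat_form (Lam n lam Rinv ap a) x x"
    "0 \<le> mat_form (Lam n lam Rinv ap a) x x"
    using 1 3 4 eq by simp_all
  have "(\<Sum>i<n. x i)\<^sup>2 / lam0 lam \<le> mat_form (Lam n lam Rinv ap a) x x"
    using 1 3 eq by simp
  then show "(\<Sum>i<n. x i)\<^sup>2 \<le> lam0 lam * mat_form (Lam n lam Rinv ap a) x x"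
    using l by (simp add: field_simps)
qed

lemma Lam12_sym:
  assumes "admissible n lam Rinv ap a" "i < n" "j < n"
  shows "(Lam1 n a + Lam2 n ap) $$ (i, j) = (Lam1 n a + Lam2 n ap) $$ (j, i)"
  using assms by (auto simp: Lam1_def Lam2_def admissible_def mult.commute)

lemma Lam_sym:
  assumes "admissible n lam Rinv ap a" "i < n" "j < n"
  shows "Lam n lam Rinv ap a $$ (i, j) = Lam n lam Rinv ap a $$ (j, i)"
  using Lam12_sym[OF assms] assms(2,3)
  by (simp add: Lam_def Lam3_def Lam4_def Lam1_def Lam2_def)

text \<open>A kernel vector v would make the form of \<Lambda> vanish at v, while \<Lambda>3 bounds
  that form below by a positive multiple of the squared length of v. Hence the determinant is
  nonzero and \<open>mat_inverse\<close> does not return \<open>None\<close>.\<close>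

lemma Lam_inv_inverts:
  assumes adm: "admissible n lam Rinv ap a" and n: "n \<ge> 1"
  shows "Lam_inv n lam Rinv ap a \<in> carrier_mat n n"
    and "Lam n lam Rinv ap a * Lam_inv n lam Rinv ap a = 1\<^sub>m n"
proof -
  let ?L = "Lam n lam Rinv ap a"
  have L: "?L \<in> carrier_mat n n" by simp
  have "Determinant.det ?L \<noteq> 0"
  proof
    assume "Determinant.det ?L = 0"
    then obtain v where v: "v \<in> carrier_vec n" "v \<noteq> 0\<^sub>v n" "?L *\<^sub>v v = 0\<^sub>v n"
      using det_0_iff_vec_prod_zero_field[OF L] by blast
    have "(\<Sum>j<n. ?L $$ (i, j) * Matrix.vec_index v j) = 0" if "i < n" for i
    proof -
      have "Matrix.vec_index (?L *\<^sub>v v) i = 0" using v(3) that by simp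
      then show ?thesis using that v(1) L
        by (simp add: scalar_prod_def lessThan_atLeast0)
    qed
    then have "mat_form ?L (Matrix.vec_index v) (Matrix.vec_index v) = 0"
      by (simp add: mat_form_def carrier_matD[OF L])
    then have "R_const n Rinv * (\<Sum>i<n. (Matrix.vec_index v i)\<^sup>2) \<le> 0"
      using Lam_bounds(3)[OF adm n, of "Matrix.vec_index v"] by simp
    then have "(\<Sum>i<n. (Matrix.vec_index v i)\<^sup>2) \<le> 0"
      using R_const_pos[OF adm n] by (simp add: mult_le_0_iff)
    then have "(\<Sum>i<n. (Matrix.vec_index v i)\<^sup>2) = 0"
      by (meson order.antisym sum_nonneg zero_le_power2)
    then have "v = 0\<^sub>v n"
      using v(1) by (intro eq_vecI) (auto simp: sum_nonneg_eq_0_iff)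
    with v(2) show False by simp
  qed
  then have "?L \<in> Units (ring_mat TYPE(real) n ())"
    by (rule det_non_zero_imp_unit[OF L])
  then obtain B where B: "mat_inverse ?L = Some B"
    using mat_inverse(1)[OF L, of "()"] by (cases "mat_inverse ?L") auto
  from mat_inverse(2)[OF L B] B
  show "Lam_inv n lam Rinv ap a \<in> carrier_mat n n"
    "?L * Lam_inv n lam Rinv ap a = 1\<^sub>m n"
    by (simp_all add: Lam_inv_def)
qed

text \<open>With \<open>x = \<Lambda>\<^sup>-\<^sup>1 q\<close> one has \<open>p \<bullet> q = p \<bullet> \<Lambda> x\<close> and \<open>x \<bullet> \<Lambda> x = \<Lambda>\<^sup>-\<^sup>1 q \<bullet> q\<close>,
  so this is the Cauchy-Schwarz inequality for \<open>\<Lambda>\<close>.\<close>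

lemma Lam_duality:
  assumes adm: "admissible n lam Rinv ap a" and n: "n \<ge> 1"
  shows "0 \<le> mat_form (Lam_inv n lam Rinv ap a) q q"
    and "\<bar>\<Sum>i<n. p i * q i\<bar> \<le>
      sqrt (mat_form (Lam n lam Rinv ap a) p p) * sqrt (mat_form (Lam_inv n lam Rinv ap a) q q)"
proof -
  let ?L = "Lam n lam Rinv ap a" and ?B = "Lam_inv n lam Rinv ap a"
  have L: "?L \<in> carrier_mat n n" by simp
  note B = Lam_inv_inverts[OF adm n]
  define x where "x k = (\<Sum>j<n. ?B $$ (k, j) * q j)" for k
  have Lx: "(\<Sum>k<n. ?L $$ (i, k) * x k) = q i" if i: "i < n" for i
  proof -
    have "(\<Sum>k<n. ?L $$ (i, k) * ?B $$ (k, j)) = (if i = j then 1 else 0)" if j: "j < n" for j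
    proof -
      have "(?L * ?B) $$ (i, j) = (if i = j then 1 else 0)"
        using B(2) i j by simp
      then show ?thesis using i j L B(1)
        by (simp add: scalar_prod_def lessThan_atLeast0)
    qed
    then have "(\<Sum>j<n. (\<Sum>k<n. ?L $$ (i, k) * ?B $$ (k, j)) * q j) = q i"
      using i by (simp add: if_distrib[of "\<lambda>c. c * _"] cong: if_cong)
    \<comment> \<open>Associativity of the product of \<Lambda>, its inverse and q, as an exchange
      of sums.\<close>
    moreover have "(\<Sum>k<n. ?L $$ (i, k) * x k) =
        (\<Sum>j<n. (\<Sum>k<n. ?L $$ (i, k) * ?B $$ (k, j)) * q j)"
      unfolding x_def sum_distrib_left sum_distrib_right mult.assoc by (rule sum.swap)
    ultimately show ?thesis by simp
  qed
  have form: "mat_form ?L x y = (\<Sum>i<n. q i * y i)" for y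
    using Lx by (simp add: mat_form_def carrier_matD[OF L])
  have Bq: "mat_form ?B q q = mat_form ?L x x"
    using B(1) unfolding form by (simp add: mat_form_def x_def mult.commute)
  then show "0 \<le> mat_form ?B q q"
    using Lam_bounds(4)[OF adm n] by simp
  have "\<bar>mat_form ?L p x\<bar> \<le> sqrt (mat_form ?L p p) * sqrt (mat_form ?L x x)"
    by (rule mat_form_Cauchy_Schwarz[OF L Lam_sym[OF adm] Lam_bounds(4)[OF adm n]])
  moreover have "mat_form ?L p x = (\<Sum>i<n. p i * q i)"
    using mat_form_commute[OF L Lam_sym[OF adm], of p x] form[of p] by (simp add: mult.commute)
  ultimately show "\<bar>\<Sum>i<n. p i * q i\<bar> \<le> sqrt (mat_form ?L p p) * sqrt (mat_form ?B q q)"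
    using Bq by simp
qed

section \<open>The terms of the bilinear form\<close>

definition U_density ::
  "(real^'d) set \<Rightarrow> real \<Rightarrow> (real^'d \<Rightarrow> real^'d) \<Rightarrow> (real^'d \<Rightarrow> real^'d) \<Rightarrow> real^'d \<Rightarrow> real" where
  "U_density \<Omega> lam u w x =
     inner (sym_grad \<Omega> u x) (sym_grad \<Omega> w x) + lam * (div_H1 \<Omega> u x * div_H1 \<Omega> w x)"

lemma U_density_integrable:
  assumes "u \<in> H10_vec \<Omega>" "w \<in> H10_vec \<Omega>"
  shows "integrable (lebesgue_on \<Omega>) (U_density \<Omega> lam u w)"
  unfolding U_density_def[abs_def]
  using sym_grad_inner_integrable[OF assms]
    L2_mult_integrable[OF div_H1_L2[OF assms(1)] div_H1_L2[OF assms(2)]]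
  by simp

lemma U_inner_eq_integral:
  assumes "u \<in> H10_vec \<Omega>" "w \<in> H10_vec \<Omega>"
  shows "U_inner \<Omega> lam u w = (LINT x|lebesgue_on \<Omega>. U_density \<Omega> lam u w x)"
  unfolding U_density_def U_inner_def l2_inner_def
  using sym_grad_inner_integrable[OF assms]
    L2_mult_integrable[OF div_H1_L2[OF assms(1)] div_H1_L2[OF assms(2)]]
  by simp

lemma U_density_nonneg: "lam > 0 \<Longrightarrow> 0 \<le> U_density \<Omega> lam u u x"
  by (simp add: U_density_def)

lemma U_density_Cauchy_Schwarz:
  assumes "lam > 0"
  shows "\<bar>U_density \<Omega> lam u w x\<bar> \<le> sqrt (U_density \<Omega> lam u u x) * sqrt (U_density \<Omega> lam w w x)"
proof -
  \<comment> \<open>These pairs turn the density into an inner product on a product space; the two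
    factors sqrt lam multiply to lam.\<close>
  let ?f = "\<lambda>u. (sym_grad \<Omega> u x, sqrt lam * div_H1 \<Omega> u x)"
  have "U_density \<Omega> lam u w x = inner (?f u) (?f w)" for u w
    using assms by (simp add: U_density_def inner_prod_def algebra_simps)
  then show ?thesis
    using Cauchy_Schwarz_ineq2[of "?f u" "?f w"] by (simp add: norm_eq_sqrt_inner)
qed

lemma U_inner_bound:
  assumes "lam > 0" "u \<in> H10_vec \<Omega>" "w \<in> H10_vec \<Omega>"
  shows "\<bar>U_inner \<Omega> lam u w\<bar> \<le> U_norm \<Omega> lam u * U_norm \<Omega> lam w"
  unfolding U_norm_def U_inner_eq_integral[OF assms(2,3)] U_inner_eq_integral[OF assms(2,2)]
    U_inner_eq_integral[OF assms(3,3)]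
  by (intro integral_abs_le_sqrt_mult_sqrt U_density_integrable U_density_nonneg
      U_density_Cauchy_Schwarz assms)

text \<open>The argument gives 3 in dimension at most 3; the larger 4 has the square root 2, which
  becomes the factor in \<open>pressure_divergence_bound\<close>.\<close>

lemma lam0_div_H1_square_le:
  fixes u :: "real^'d \<Rightarrow> real^'d"
  assumes "lam > 0" "CARD('d) \<le> 3"
  shows "lam0 lam * (div_H1 \<Omega> u x)\<^sup>2 \<le> 4 * U_density \<Omega> lam u u x"
proof -
  let ?e = "inner (sym_grad \<Omega> u x) (sym_grad \<Omega> u x)"
  have "lam0 lam * (div_H1 \<Omega> u x)\<^sup>2 \<le> (1 + lam) * (div_H1 \<Omega> u x)\<^sup>2"
    using assms(1) by (intro mult_right_mono) (auto simp: lam0_def)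
  moreover have "(div_H1 \<Omega> u x)\<^sup>2 \<le> 3 * ?e"
  proof -
    have "real CARD('d) * ?e \<le> 3 * ?e" using assms(2) by (intro mult_right_mono) auto
    then show ?thesis using div_H1_square_le[of \<Omega> u x] by linarith
  qed
  moreover have "0 \<le> ?e" "0 \<le> lam * (div_H1 \<Omega> u x)\<^sup>2" using assms(1) by auto
  moreover have "U_density \<Omega> lam u u x = ?e + lam * (div_H1 \<Omega> u x)\<^sup>2"
    by (simp add: U_density_def power2_eq_square)
  ultimately show ?thesis
    by (simp only: distrib_left distrib_right mult_1_left)
qed

section \<open>Pressure coupling to the displacement, and exchange\<close>

lemma P_inner_eq_integral:
  assumes "p \<in> P_space n \<Omega>" "q \<in> P_space n \<Omega>"
  shows "P_inner \<Omega> n lam Rinv ap a p q =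
    (LINT x|lebesgue_on \<Omega>. mat_form (Lam n lam Rinv ap a) (\<lambda>i. p i x) (\<lambda>i. q i x))"
  unfolding P_inner_def by (rule l2_inner_tuple_mat_apply) (auto intro: P_space_L2 assms)

lemma pressure_divergence_bound:
  fixes \<Omega> :: "(real^'d) set"
  assumes adm: "admissible n lam Rinv ap a" and n: "n \<ge> 1" and d: "CARD('d) \<le> 3"
    and p: "p \<in> P_space n \<Omega>" and w: "w \<in> H10_vec \<Omega>"
  shows "\<bar>l2_inner \<Omega> (\<lambda>x. \<Sum>i<n. p i x) (div_H1 \<Omega> w)\<bar>
    \<le> 2 * (P_norm \<Omega> n lam Rinv ap a p * U_norm \<Omega> lam w)"
proof -
  let ?L = "Lam n lam Rinv ap a"
  have lam: "lam > 0" using adm by (simp add: admissible_def)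
  have "\<bar>LINT x|lebesgue_on \<Omega>. (\<Sum>i<n. p i x) * div_H1 \<Omega> w x\<bar>
    \<le> sqrt (LINT x|lebesgue_on \<Omega>. mat_form ?L (\<lambda>i. p i x) (\<lambda>i. p i x))
      * sqrt (LINT x|lebesgue_on \<Omega>. 4 * U_density \<Omega> lam w w x)"
  proof (rule integral_abs_le_sqrt_mult_sqrt)
    show "integrable (lebesgue_on \<Omega>) (\<lambda>x. mat_form ?L (\<lambda>i. p i x) (\<lambda>i. p i x))"
      by (rule mat_form_integrable[of _ n]) (auto intro: P_space_L2 p)
    show "integrable (lebesgue_on \<Omega>) (\<lambda>x. 4 * U_density \<Omega> lam w w x)"
      using U_density_integrable[OF w w] by simp
    fix x
    let ?s = "\<Sum>i<n. p i x" and ?g = "div_H1 \<Omega> w x"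
    let ?P = "mat_form ?L (\<lambda>i. p i x) (\<lambda>i. p i x)" and ?U = "U_density \<Omega> lam w w x"
    show nn: "0 \<le> ?P" "0 \<le> 4 * ?U"
      using Lam_bounds(4)[OF adm n] U_density_nonneg[OF lam] by simp_all
    have l: "lam0 lam > 0" by (simp add: lam0_def)
    \<comment> \<open>One factor \<open>lam0 lam\<close> comes from the bound on \<open>?s\<close>,
      the other is absorbed by \<open>?g\<close>. Multiplying the claim by \<open>lam0 lam\<close>
      lets it cancel, which leaves a constant free of parameters.\<close>
    have "lam0 lam * (?s * ?g)\<^sup>2 = ?s\<^sup>2 * (lam0 lam * ?g\<^sup>2)"
      by (simp add: power_mult_distrib)
    also have "\<dots> \<le> (lam0 lam * ?P) * (4 * ?U)"
      using l nn
      by (intro mult_mono Lam_bounds(2)[OF adm n] lam0_div_H1_square_le[OF lam d]) simp_all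
    also have "\<dots> = lam0 lam * (?P * (4 * ?U))" by simp
    finally have "(?s * ?g)\<^sup>2 \<le> ?P * (4 * ?U)" using l by (simp only: mult_le_cancel_left_pos)
    then have "\<bar>?s * ?g\<bar> \<le> sqrt (?P * (4 * ?U))"
      by (metis real_sqrt_abs real_sqrt_le_mono)
    then show "\<bar>?s * ?g\<bar> \<le> sqrt ?P * sqrt (4 * ?U)"
      by (simp only: real_sqrt_mult)
  qed
  then show ?thesis
    unfolding P_norm_def U_norm_def P_inner_eq_integral[OF p p] U_inner_eq_integral[OF w w]
    by (simp add: l2_inner_def real_sqrt_mult)
qed

lemma exchange_bound:
  assumes adm: "admissible n lam Rinv ap a" and n: "n \<ge> 1"
    and p: "p \<in> P_space n \<Omega>" and q: "q \<in> P_space n \<Omega>"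
  shows "\<bar>l2_inner_tuple n \<Omega> (mat_apply (Lam1 n a + Lam2 n ap) p) q\<bar>
    \<le> P_norm \<Omega> n lam Rinv ap a p * P_norm \<Omega> n lam Rinv ap a q"
proof -
  have eq: "l2_inner_tuple n \<Omega> (mat_apply (Lam1 n a + Lam2 n ap) p) q =
      (LINT x|lebesgue_on \<Omega>. mat_form (Lam1 n a + Lam2 n ap) (\<lambda>i. p i x) (\<lambda>i. q i x))"
    by (rule l2_inner_tuple_mat_apply) (auto intro: P_space_L2 p q)
  show ?thesis
    unfolding eq P_norm_def P_inner_eq_integral[OF p p] P_inner_eq_integral[OF q q]
  proof (rule integral_abs_le_sqrt_mult_sqrt)
    fix x
    have "\<bar>mat_form (Lam1 n a + Lam2 n ap) (\<lambda>i. p i x) (\<lambda>i. q i x)\<bar>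
      \<le> sqrt (mat_form (Lam1 n a + Lam2 n ap) (\<lambda>i. p i x) (\<lambda>i. p i x))
        * sqrt (mat_form (Lam1 n a + Lam2 n ap) (\<lambda>i. q i x) (\<lambda>i. q i x))"
      by (rule mat_form_Cauchy_Schwarz[OF _ Lam12_sym[OF adm] Lam12_psd[OF adm]]) auto
    \<comment> \<open>The comparison with \<Lambda> holds for equal arguments, so it follows
      Cauchy-Schwarz instead of preceding it.\<close>
    also have "\<dots> \<le> sqrt (mat_form (Lam n lam Rinv ap a) (\<lambda>i. p i x) (\<lambda>i. p i x))
        * sqrt (mat_form (Lam n lam Rinv ap a) (\<lambda>i. q i x) (\<lambda>i. q i x))"
      using Lam_bounds(1)[OF adm n] Lam12_psd[OF adm] Lam_bounds(4)[OF adm n]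
      by (intro mult_mono real_sqrt_le_mono real_sqrt_ge_zero)
    finally show "\<bar>mat_form (Lam1 n a + Lam2 n ap) (\<lambda>i. p i x) (\<lambda>i. q i x)\<bar> \<le> \<dots>" .
  qed (use Lam_bounds(4)[OF adm n] in \<open>auto intro!: mat_form_integrable[of _ n] P_space_L2 p q\<close>)
qed

section \<open>Flux terms and the duality of pressure and flux divergence\<close>

definition flux_density ::
  "nat \<Rightarrow> (nat \<Rightarrow> real) \<Rightarrow> (nat \<Rightarrow> real^'d \<Rightarrow> real^'d) \<Rightarrow> (nat \<Rightarrow> real^'d \<Rightarrow> real^'d) \<Rightarrow> real^'d \<Rightarrow> real"
  where "flux_density n Rinv v z x = (\<Sum>i<n. Rinv i * inner (v i x) (z i x))"

lemma flux_density_integrable: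
  assumes "v \<in> V_space n \<Omega>" "z \<in> V_space n \<Omega>"
  shows "integrable (lebesgue_on \<Omega>) (flux_density n Rinv v z)"
  unfolding flux_density_def[abs_def]
  by (intro Bochner_Integration.integrable_sum integrable_mult_right L2_inner_integrable
      V_space_L2(1)[OF assms(1)] V_space_L2(1)[OF assms(2)]) auto

lemma flux_term_eq_integral:
  assumes "v \<in> V_space n \<Omega>" "z \<in> V_space n \<Omega>"
  shows "(\<Sum>i<n. l2_inner \<Omega> (\<lambda>x. Rinv i *\<^sub>R v i x) (z i)) =
    (LINT x|lebesgue_on \<Omega>. flux_density n Rinv v z x)"
  unfolding flux_density_def l2_inner_def inner_scaleR_left
  using L2_inner_integrable[OF V_space_L2(1)[OF assms(1)] V_space_L2(1)[OF assms(2)]]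
  by (subst Bochner_Integration.integral_sum) auto

lemma flux_density_nonneg:
  assumes "admissible n lam Rinv ap a"
  shows "0 \<le> flux_density n Rinv v v x"
  unfolding flux_density_def using assms
  by (intro sum_nonneg mult_nonneg_nonneg) (auto simp: admissible_def less_imp_le)

text \<open>Cauchy-Schwarz in each component i, then Young's inequality with one t common to all i;
  the weighted sums reassemble into the two densities without a factor depending on n.\<close>

lemma flux_density_Cauchy_Schwarz:
  assumes adm: "admissible n lam Rinv ap a"
  shows "\<bar>flux_density n Rinv v z x\<bar> \<le>
    sqrt (flux_density n Rinv v v x) * sqrt (flux_density n Rinv z z x)"
proof (rule le_sqrt_mult_sqrtI[OF flux_density_nonneg[OF adm] flux_density_nonneg[OF adm]])
  fix t :: real assume t: "t > 0"
  have "2 * \<bar>flux_density n Rinv v z x\<bar> \<le> 2 * (\<Sum>i<n. Rinv i * (norm (v i x) * norm (z i x)))"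
  proof -
    have "\<bar>flux_density n Rinv v z x\<bar> \<le> (\<Sum>i<n. \<bar>Rinv i * inner (v i x) (z i x)\<bar>)"
      unfolding flux_density_def by (rule sum_abs)
    also have "\<dots> \<le> (\<Sum>i<n. Rinv i * (norm (v i x) * norm (z i x)))"
      using adm by (intro sum_mono)
        (auto simp: abs_mult admissible_def Cauchy_Schwarz_ineq2 intro!: mult_mono)
    finally show ?thesis by simp
  qed
  also have "\<dots> = (\<Sum>i<n. Rinv i * (2 * (norm (v i x) * norm (z i x))))"
    by (simp add: sum_distrib_left mult.left_commute)
  also have "\<dots> \<le> (\<Sum>i<n. Rinv i * (t * (norm (v i x))\<^sup>2 + (norm (z i x))\<^sup>2 / t))"
    using adm two_mult_le_weighted_squares[OF t]
    by (intro sum_mono mult_left_mono) (auto simp: admissible_def less_imp_le)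
  also have "\<dots> = t * flux_density n Rinv v v x + flux_density n Rinv z z x / t"
    by (simp add: flux_density_def power2_norm_eq_inner sum_distrib_left sum_divide_distrib
        sum.distrib[symmetric] algebra_simps)
  finally show "2 * \<bar>flux_density n Rinv v z x\<bar> \<le>
    t * flux_density n Rinv v v x + flux_density n Rinv z z x / t" .
qed

lemma V_inner_eq_integrals:
  assumes adm: "admissible n lam Rinv ap a" and n: "n \<ge> 1" and v: "v \<in> V_space n \<Omega>"
  shows "V_inner \<Omega> n lam Rinv ap a v v = (LINT x|lebesgue_on \<Omega>. flux_density n Rinv v v x) +
    (LINT x|lebesgue_on \<Omega>.
      mat_form (Lam_inv n lam Rinv ap a) (\<lambda>i. Div \<Omega> v i x) (\<lambda>i. Div \<Omega> v i x))"
  unfolding V_inner_def flux_term_eq_integral[OF v v]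
  by (subst l2_inner_tuple_mat_apply[OF Lam_inv_inverts(1)[OF adm n]])
    (auto intro: V_space_L2(2)[OF v])

text \<open>Both parts of the squared V norm are nonnegative, so each alone is dominated.
  \<open>flux_bound\<close> uses the first, \<open>pressure_Div_bound\<close> the second.\<close>

lemma V_norm_ge:
  assumes adm: "admissible n lam Rinv ap a" and n: "n \<ge> 1" and v: "v \<in> V_space n \<Omega>"
  shows "sqrt (LINT x|lebesgue_on \<Omega>. flux_density n Rinv v v x) \<le> V_norm \<Omega> n lam Rinv ap a v"
    and "sqrt (LINT x|lebesgue_on \<Omega>.
      mat_form (Lam_inv n lam Rinv ap a) (\<lambda>i. Div \<Omega> v i x) (\<lambda>i. Div \<Omega> v i x))
      \<le> V_norm \<Omega> n lam Rinv ap a v"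
proof -
  have "0 \<le> (LINT x|lebesgue_on \<Omega>. flux_density n Rinv v v x)"
    by (simp add: flux_density_nonneg[OF adm])
  moreover have "0 \<le> (LINT x|lebesgue_on \<Omega>.
      mat_form (Lam_inv n lam Rinv ap a) (\<lambda>i. Div \<Omega> v i x) (\<lambda>i. Div \<Omega> v i x))"
    using Lam_duality(1)[OF adm n] by simp
  ultimately show "sqrt (LINT x|lebesgue_on \<Omega>. flux_density n Rinv v v x) \<le> V_norm \<Omega> n lam Rinv ap a v"
    "sqrt (LINT x|lebesgue_on \<Omega>.
      mat_form (Lam_inv n lam Rinv ap a) (\<lambda>i. Div \<Omega> v i x) (\<lambda>i. Div \<Omega> v i x))
      \<le> V_norm \<Omega> n lam Rinv ap a v"
    unfolding V_norm_def V_inner_eq_integrals[OF assms] by simp_all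
qed

lemma flux_bound:
  assumes adm: "admissible n lam Rinv ap a" and n: "n \<ge> 1"
    and v: "v \<in> V_space n \<Omega>" and z: "z \<in> V_space n \<Omega>"
  shows "\<bar>\<Sum>i<n. l2_inner \<Omega> (\<lambda>x. Rinv i *\<^sub>R v i x) (z i)\<bar>
    \<le> V_norm \<Omega> n lam Rinv ap a v * V_norm \<Omega> n lam Rinv ap a z"
proof -
  have "\<bar>\<Sum>i<n. l2_inner \<Omega> (\<lambda>x. Rinv i *\<^sub>R v i x) (z i)\<bar>
    \<le> sqrt (LINT x|lebesgue_on \<Omega>. flux_density n Rinv v v x)
      * sqrt (LINT x|lebesgue_on \<Omega>. flux_density n Rinv z z x)"
    unfolding flux_term_eq_integral[OF v z]
    by (intro integral_abs_le_sqrt_mult_sqrt flux_density_integrable v z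
        flux_density_nonneg[OF adm] flux_density_Cauchy_Schwarz[OF adm])
  also have "\<dots> \<le> V_norm \<Omega> n lam Rinv ap a v * V_norm \<Omega> n lam Rinv ap a z"
    by (intro mult_mono' V_norm_ge[OF adm n] v z)
      (simp_all add: Bochner_Integration.integral_nonneg flux_density_nonneg[OF adm])
  finally show ?thesis .
qed

lemma pressure_Div_bound:
  assumes adm: "admissible n lam Rinv ap a" and n: "n \<ge> 1"
    and p: "p \<in> P_space n \<Omega>" and z: "z \<in> V_space n \<Omega>"
  shows "\<bar>l2_inner_tuple n \<Omega> p (Div \<Omega> z)\<bar>
    \<le> P_norm \<Omega> n lam Rinv ap a p * V_norm \<Omega> n lam Rinv ap a z"
proof -
  have eq: "l2_inner_tuple n \<Omega> p (Div \<Omega> z) = (LINT x|lebesgue_on \<Omega>. (\<Sum>i<n. p i x * Div \<Omega> z i x))"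
    by (rule l2_inner_tuple_eq) (auto intro: P_space_L2[OF p] V_space_L2(2)[OF z])
  \<comment> \<open>The pointwise bound to integrate is \<open>Lam_duality\<close> at the values of
    p and Div z.\<close>
  have "\<bar>l2_inner_tuple n \<Omega> p (Div \<Omega> z)\<bar> \<le> P_norm \<Omega> n lam Rinv ap a p *
    sqrt (LINT x|lebesgue_on \<Omega>.
      mat_form (Lam_inv n lam Rinv ap a) (\<lambda>i. Div \<Omega> z i x) (\<lambda>i. Div \<Omega> z i x))"
    unfolding eq P_norm_def P_inner_eq_integral[OF p p]
    by (intro integral_abs_le_sqrt_mult_sqrt mat_form_integrable[of _ n] Lam_inv_inverts(1)[OF adm n]
        parameter_mat_carrier Lam_bounds(4)[OF adm n] Lam_duality[OF adm n]
        P_space_L2[OF p] V_space_L2(2)[OF z])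
  also have "\<dots> \<le> P_norm \<Omega> n lam Rinv ap a p * V_norm \<Omega> n lam Rinv ap a z"
  proof (rule mult_left_mono[OF V_norm_ge(2)[OF adm n z]])
    show "0 \<le> P_norm \<Omega> n lam Rinv ap a p"
      unfolding P_norm_def P_inner_eq_integral[OF p p] using Lam_bounds(4)[OF adm n] by simp
  qed
  finally show ?thesis .
qed

section \<open>Assembly of the bound\<close>

lemma l2_inner_commute: "l2_inner \<Omega> f g = l2_inner \<Omega> g f"
  by (simp add: l2_inner_def inner_commute)

lemma l2_inner_tuple_commute: "l2_inner_tuple n \<Omega> p q = l2_inner_tuple n \<Omega> q p"
  by (simp add: l2_inner_tuple_def l2_inner_commute)

text \<open>The real \<open>sqrt\<close> is odd, hence negative on negative arguments, so the sign
  of a norm rests on that of its quadratic form.\<close>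

lemma norms_nonneg:
  assumes adm: "admissible n lam Rinv ap a" and n: "n \<ge> 1"
    and "u \<in> H10_vec \<Omega>" "v \<in> V_space n \<Omega>" "p \<in> P_space n \<Omega>"
  shows "0 \<le> U_norm \<Omega> lam u" "0 \<le> V_norm \<Omega> n lam Rinv ap a v" "0 \<le> P_norm \<Omega> n lam Rinv ap a p"
proof -
  have "lam > 0" using adm by (simp add: admissible_def)
  then show "0 \<le> U_norm \<Omega> lam u"
    by (simp add: U_norm_def U_inner_eq_integral assms U_density_nonneg)
  show "0 \<le> V_norm \<Omega> n lam Rinv ap a v"
    using V_norm_ge(2)[OF adm n assms(4)] Lam_duality(1)[OF adm n]
    by (meson Bochner_Integration.integral_nonneg order.trans real_sqrt_ge_zero)
  show "0 \<le> P_norm \<Omega> n lam Rinv ap a p"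
    by (simp add: P_norm_def P_inner_eq_integral assms Lam_bounds(4)[OF adm n])
qed

lemma A_form_bound:
  fixes \<Omega> :: "(real^'d) set"
  assumes adm: "admissible n lam Rinv ap a" and n: "n \<ge> 1" and d: "CARD('d) \<le> 3"
    and u: "u \<in> H10_vec \<Omega>" and v: "v \<in> V_space n \<Omega>" and p: "p \<in> P_space n \<Omega>"
    and w: "w \<in> H10_vec \<Omega>" and z: "z \<in> V_space n \<Omega>" and q: "q \<in> P_space n \<Omega>"
  shows "\<bar>A_form \<Omega> n lam Rinv ap a (u, v, p) (w, z, q)\<bar>
     \<le> 2 * (U_norm \<Omega> lam u + V_norm \<Omega> n lam Rinv ap a v + P_norm \<Omega> n lam Rinv ap a p)
         * (U_norm \<Omega> lam w + V_norm \<Omega> n lam Rinv ap a z + P_norm \<Omega> n lam Rinv ap a q)"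
proof -
  define U V P where "U = U_norm \<Omega> lam u" "V = V_norm \<Omega> n lam Rinv ap a v"
    "P = P_norm \<Omega> n lam Rinv ap a p"
  define W Z Q where "W = U_norm \<Omega> lam w" "Z = V_norm \<Omega> n lam Rinv ap a z"
    "Q = P_norm \<Omega> n lam Rinv ap a q"
  note defs = U_V_P_def W_Z_Q_def
  have lam: "lam > 0" using adm by (simp add: admissible_def)
  have nonneg: "0 \<le> U" "0 \<le> V" "0 \<le> P" "0 \<le> W" "0 \<le> Z" "0 \<le> Q"
    unfolding defs using norms_nonneg[OF adm n u v p] norms_nonneg[OF adm n w z q] by simp_all
  \<comment> \<open>The terms in q are commuted into the shape of the terms in p, so that each
    coupling estimate serves twice.\<close>
  have A: "A_form \<Omega> n lam Rinv ap a (u, v, p) (w, z, q) =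
     U_inner \<Omega> lam u w
     - l2_inner \<Omega> (\<lambda>x. \<Sum>i<n. p i x) (div_H1 \<Omega> w)
     + (\<Sum>i<n. l2_inner \<Omega> (\<lambda>x. Rinv i *\<^sub>R v i x) (z i))
     - l2_inner_tuple n \<Omega> p (Div \<Omega> z)
     - l2_inner \<Omega> (\<lambda>x. \<Sum>i<n. q i x) (div_H1 \<Omega> u)
     - l2_inner_tuple n \<Omega> q (Div \<Omega> v)
     - l2_inner_tuple n \<Omega> (mat_apply (Lam1 n a + Lam2 n ap) p) q"
    by (simp add: A_form_def U_inner_def l2_inner_commute[of \<Omega> "div_H1 \<Omega> u" "\<lambda>x. \<Sum>i<n. q i x"]
        l2_inner_tuple_commute[of n \<Omega> "Div \<Omega> v" q])
  have "\<bar>A_form \<Omega> n lam Rinv ap a (u, v, p) (w, z, q)\<bar>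
      \<le> U * W + 2 * (P * W) + V * Z + P * Z + 2 * (Q * U) + Q * V + P * Q"
    unfolding A
    using U_inner_bound[OF lam u w, folded defs]
      pressure_divergence_bound[OF adm n d p w, folded defs] flux_bound[OF adm n v z, folded defs]
      pressure_Div_bound[OF adm n p z, folded defs]
      pressure_divergence_bound[OF adm n d q u, folded defs]
      pressure_Div_bound[OF adm n q v, folded defs] exchange_bound[OF adm n p q, folded defs]
    by linarith
  \<comment> \<open>Expanding the right side gives nine products, each with coefficient 2. Seven of
    them occur on the left with coefficient 1 or 2; U Z and V W do not occur there and are
    nonnegative.\<close>
  also have "\<dots> \<le> 2 * (U + V + P) * (W + Z + Q)"
  proof -
    have "0 \<le> U * W" "0 \<le> U * Z" "0 \<le> V * W" "0 \<le> V * Z" "0 \<le> P * Z" "0 \<le> Q * V" "0 \<le> P * Q"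
      using nonneg by simp_all
    then show ?thesis by (simp add: algebra_simps)
  qed
  finally show ?thesis unfolding defs .
qed

theorem theorem2:
  fixes \<Omega> :: "(real^'d) set"
  assumes "CARD('d) \<in> {2, 3}"
    and "bounded_lipschitz_domain \<Omega>"
  shows "\<exists>C\<^sub>b::real. \<forall>n\<ge>1. \<forall>lam Rinv ap a. admissible n lam Rinv ap a \<longrightarrow>
    (\<forall>u\<in>H10_vec \<Omega>. \<forall>v\<in>V_space n \<Omega>. \<forall>p\<in>P_space n \<Omega>.
     \<forall>w\<in>H10_vec \<Omega>. \<forall>z\<in>V_space n \<Omega>. \<forall>q\<in>P_space n \<Omega>.
       \<bar>A_form \<Omega> n lam Rinv ap a (u, v, p) (w, z, q)\<bar>
       \<le> C\<^sub>b * (U_norm \<Omega> lam u + V_norm \<Omega> n lam Rinv ap a v + P_norm \<Omega> n lam Rinv ap a p)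
            * (U_norm \<Omega> lam w + V_norm \<Omega> n lam Rinv ap a z + P_norm \<Omega> n lam Rinv ap a q))"
proof (intro exI[of _ 2] allI impI ballI)
  \<comment> \<open>The dimension enters through this bound, used in
    \<open>lam0_div_H1_square_le\<close>.\<close>
  have "CARD('d) \<le> 3" using assms(1) by auto
  then show "\<bar>A_form \<Omega> n lam Rinv ap a (u, v, p) (w, z, q)\<bar>
       \<le> 2 * (U_norm \<Omega> lam u + V_norm \<Omega> n lam Rinv ap a v + P_norm \<Omega> n lam Rinv ap a p)
            * (U_norm \<Omega> lam w + V_norm \<Omega> n lam Rinv ap a z + P_norm \<Omega> n lam Rinv ap a q)"
    if "1 \<le> n" "admissible n lam Rinv ap a" "u \<in> H10_vec \<Omega>" "v \<in> V_space n \<Omega>" "p \<in> P_space n \<Omega>"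
      "w \<in> H10_vec \<Omega>" "z \<in> V_space n \<Omega>" "q \<in> P_space n \<Omega>" for n lam Rinv ap a u v p w z q
    using that by (intro A_form_bound)
qed

end
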